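(* Let $\mathbf P$ be an irreducible $s\times s$ stochastic matrix with stationary row vector $\boldsymbol\pi$, $\mathbf a$ a known initial law (row vector), $1\le r\le s-1$, $U=\{1,\ldots,r\}$, $D=\{r+1,\ldots,s\}$. Let $\mathbf e_U,\mathbf e_D\in\mathbb R^{s\times1}$ be the indicator column vectors of $U$ and $D$, and $\mathbf J_U$ the $s\times s$ diagonal matrix with diagonal $\mathbf e_U$. For $k\ge1$ let $$r_k=\mathbb P(X_{k-1}\in U,X_k\in D)=\mathbf a\mathbf P^{k-1}\mathbf J_U\mathbf P\mathbf e_D,\qquad \widehat r_k(n)=\mathbf a\widehat{\mathbf P}(n)^{k-1}\mathbf J_U\widehat{\mathbf P}(n)\mathbf e_D.$$ Then, for $k\ge1$, $$\sqrt n\{\widehat r_k(n)-r_k\}\xrightarrow{d}\mathbf a\Big(\mathbf W_{\mathbf P^{k-1}}\mathbf J_U\mathbf P+\mathbf P^{k-1}\mathbf J_U\mathbf W\Big)\mathbf e_D,$$ with the convention $\mathbf W_{\mathbf P^0}=\mathbf 0$. Moreover, for the stationary availability $A_\infty=\boldsymbol\pi\mathbf e_U$ and its plug-in estimator $\widehat A_\infty(n)=\widehat{\boldsymbol\pi}(n)\mathbf e_U$, $$\sqrt n\{\widehat A_\infty(n)-A_\infty\}\xrightarrow{d}\mathbf W_{\boldsymbol\pi}\mathbf e_U,\qquad \mathbf W_{\boldsymbol\pi}=\boldsymbol\pi\mathbf W(\mathbf I_s-\mathbf P+\mathbf A)^{-1},$$ where $\mathbf A$ is the $s\times s$ all-ones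 matrix.
   Context: $(X_m)_{m\ge0}$ is a time-homogeneous Markov chain on $\{1,\ldots,s\}$ with irreducible transition matrix $\mathbf P=(p_{ij})$, initial law $\mathbf a$ and stationary row vector $\boldsymbol\pi=(\pi_1,\ldots,\pi_s)=\mathbf 1_s^\top(\mathbf I_s-\mathbf P+\mathbf A)^{-1}$, where $\mathbf 1_s=(1,\ldots,1)^\top$, observed along a single trajectory $X_0,\ldots,X_n$. $N_{ij}(n)$ is the number of transitions from $i$ to $j$ up to time $n$, $N_i(n)=\sum_jN_{ij}(n)$, and $\widehat{\mathbf P}(n)$ has entries $N_{ij}(n)/N_i(n)$ (and $0$ if $N_i(n)=0$). $\widehat{\boldsymbol\pi}(n)=\mathbf 1_s^\top(\mathbf I_s-\widehat{\mathbf P}(n)+\mathbf A)^{-1}$ (arbitrary when the inverse does not exist). Limits are as $n\to\infty$; $\xrightarrow{d}$ is convergence in distribution. $\mathbf W=(W_{ij})$ is the centered Gaussian random $s\times s$ matrix with $\operatorname{Cov}(W_{ij},W_{kl})=\delta_{ik}\pi_i^{-1}p_{ij}(\delta_{jl}-p_{il})$, and for $k\ge1$, $\mathbf W_{\mathbf P^k}=\sum_{i=0}^{k-1}\mathbf P^i\mathbf W\mathbf P^{k-1-i}$. *)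

theory Defs
  imports "HOL-Probability.Probability"
begin

text \<open>Matrices are of type \<^typ>\<open>real ^ 's ^ 's\<close> with row index first, so the entry \<open>p\<^sub>i\<^sub>j\<close>
  is \<open>P $ i $ j\<close>.  Row vectors act by \<open>v*\<close>, and a row vector times a column vector is an inner product.\<close>

section \<open>Matrices\<close>

text \<open>The power \<open>P ^ n\<close> on vector types is taken entrywise, hence a separate definition.\<close>

primrec matpow :: "real ^ 's::finite ^ 's \<Rightarrow> nat \<Rightarrow> real ^ 's ^ 's" where
  "matpow P 0 = mat 1"
| "matpow P (Suc n) = P ** matpow P n"

definition all_ones :: "real ^ 's::finite ^ 's" where
  "all_ones = (\<chi> i j. 1)"

definition ind_vec :: "'s set \<Rightarrow> real ^ 's::finite" where
  "ind_vec U = (\<chi> i. indicator U i)"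

definition ind_diag :: "'s set \<Rightarrow> real ^ 's::finite ^ 's" where
  "ind_diag U = (\<chi> i j. if i = j then indicator U i else 0)"

definition stochastic_matrix :: "real ^ 's::finite ^ 's \<Rightarrow> bool" where
  "stochastic_matrix P \<longleftrightarrow> (\<forall>i j. 0 \<le> P $ i $ j) \<and> (\<forall>i. (\<Sum>j\<in>UNIV. P $ i $ j) = 1)"

definition irreducible_matrix :: "real ^ 's::finite ^ 's \<Rightarrow> bool" where
  "irreducible_matrix P \<longleftrightarrow> (\<forall>i j. \<exists>n. 0 < matpow P n $ i $ j)"

definition stationary_vec :: "real ^ 's::finite ^ 's \<Rightarrow> real ^ 's \<Rightarrow> bool" where
  "stationary_vec P \<pi> \<longleftrightarrow> (\<forall>i. 0 \<le> \<pi> $ i) \<and> (\<Sum>i\<in>UNIV. \<pi> $ i) = 1 \<and> \<pi> v* P = \<pi>"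

text \<open>With \<open>A = all_ones\<close>, the stationary vector is \<open>1\<^sup>T (I - P + A)\<^sup>-\<^sup>1\<close>, with the inverse existing;
  this is the formula whose plug-in version defines the estimator of the stationary vector.\<close>

lemma stochastic_matpow:
  assumes "stochastic_matrix P"
  shows "stochastic_matrix (matpow P n)"
proof (induction n)
  case 0
  then show ?case
    by (simp add: stochastic_matrix_def mat_def)
next
  case (Suc n)
  have "(\<Sum>j\<in>UNIV. \<Sum>k\<in>UNIV. P $ i $ k * matpow P n $ k $ j) = 1" for i
    using Suc assms
    by (subst sum.swap) (simp add: stochastic_matrix_def sum_distrib_left[symmetric])
  then show ?case
    using Suc assms by (auto simp: stochastic_matrix_def matrix_matrix_mult_def intro!: sum_nonneg)
qed

lemma harmonic_const:
  fixes P :: "real ^ 's::finite ^ 's"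
  assumes P: "stochastic_matrix P" "irreducible_matrix P" and x: "P *v x = x"
  shows "x $ i = x $ j"
proof -
  have fixpt: "matpow P n *v x = x" for n
    by (induction n) (simp_all add: x matrix_vector_mul_assoc[symmetric])
  obtain m where m: "\<And>j. x $ j \<le> x $ m"
  proof -
    have "Max (range (($) x)) \<in> range (($) x)"
      by (rule Max_in) auto
    then obtain m where "Max (range (($) x)) = x $ m"
      by blast
    moreover have "x $ j \<le> Max (range (($) x))" for j
      by (rule Max_ge) auto
    ultimately show ?thesis
      using that by metis
  qed
  have "x $ j = x $ m" for j
  proof -
    obtain n where n: "0 < matpow P n $ m $ j"
      using P(2) by (auto simp: irreducible_matrix_def)
    have st: "stochastic_matrix (matpow P n)"
      by (rule stochastic_matpow[OF P(1)])
    have "(\<Sum>j\<in>UNIV. matpow P n $ m $ j * (x $ m - x $ j))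
        = (\<Sum>j\<in>UNIV. matpow P n $ m $ j) * x $ m - (matpow P n *v x) $ m"
      by (simp add: matrix_vector_mult_def algebra_simps sum_subtractf sum_distrib_left)
    also have "\<dots> = 0"
      using st by (simp add: fixpt stochastic_matrix_def)
    finally have "\<forall>j\<in>UNIV. matpow P n $ m $ j * (x $ m - x $ j) = 0"
      using st m by (subst (asm) sum_nonneg_eq_0_iff) (auto simp: stochastic_matrix_def)
    with n show ?thesis
      by (metis UNIV_I eq_iff_diff_eq_0 less_irrefl mult_eq_0_iff)
  qed
  then show ?thesis
    by metis
qed

lemma stationary_vec_formula:
  fixes P :: "real ^ 's::finite ^ 's"
  assumes P: "stochastic_matrix P" "irreducible_matrix P" and \<pi>: "stationary_vec P \<pi>"
  shows "invertible (mat 1 - P + all_ones)"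
    and "\<pi> = 1 v* matrix_inv (mat 1 - P + all_ones)"
proof -
  let ?Z = "mat 1 - P + all_ones"
  have ones: "\<pi> v* all_ones = 1"
    using \<pi> by (simp add: vec_eq_iff vector_matrix_mult_def all_ones_def stationary_vec_def)
  have \<pi>Z: "\<pi> v* ?Z = 1"
    using \<pi> ones by (simp add: stationary_vec_def vector_matrix_mult_diff_rdistrib
        vector_matrix_mult_add_rdistrib)
  have "x = 0" if x: "?Z *v x = 0" for x
  proof -
    have "(\<Sum>i\<in>UNIV. x $ i) = (\<pi> v* ?Z) \<bullet> x"
      by (simp add: \<pi>Z inner_vec_def)
    also have "\<dots> = \<pi> \<bullet> (?Z *v x)"
      by (simp add: dot_lmul_matrix)
    finally have sum0: "(\<Sum>i\<in>UNIV. x $ i) = 0"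
      by (simp add: x)
    then have "all_ones *v x = 0"
      by (simp add: vec_eq_iff matrix_vector_mult_def all_ones_def)
    then have "P *v x = x"
      using x by (simp add: matrix_vector_mult_add_rdistrib matrix_vector_mult_diff_rdistrib)
    then have "x $ i = x $ j" for i j
      by (rule harmonic_const[OF P])
    then have "(\<Sum>j\<in>UNIV. x $ j) = of_nat CARD('s) * x $ i" for i
      by (metis (no_types, lifting) sum.cong sum_constant)
    with sum0 show ?thesis
      by (simp add: vec_eq_iff)
  qed
  then show inv: "invertible ?Z"
    by (auto simp: invertible_left_inverse matrix_left_invertible_ker)
  have "1 v* matrix_inv ?Z = \<pi> v* (?Z ** matrix_inv ?Z)"
    by (simp add: \<pi>Z vector_matrix_mul_assoc[symmetric])
  also have "?Z ** matrix_inv ?Z = mat 1"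
    using inv unfolding invertible_def matrix_inv_def by (rule someI2_ex) blast
  finally show "\<pi> = 1 v* matrix_inv ?Z"
    by simp
qed

section \<open>Markov chains and the empirical transition matrix\<close>

locale finite_markov_chain = prob_space M
  for M :: "'a measure" +
  fixes X :: "nat \<Rightarrow> 'a \<Rightarrow> 's::finite" and P :: "real ^ 's ^ 's" and a :: "real ^ 's"
  assumes measurable_X: "\<And>m. X m \<in> M \<rightarrow>\<^sub>M count_space UNIV"
    and initial_law: "\<And>i. \<P>(\<omega> in M. X 0 \<omega> = i) = a $ i"
    and markov: "\<And>m x j. \<P>(\<omega> in M. \<forall>l\<le>m. X l \<omega> = x l) > 0 \<Longrightarrow>
        \<P>(\<omega> in M. X (Suc m) \<omega> = j \<bar> \<forall>l\<le>m. X l \<omega> = x l) = P $ x m $ j"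

definition trans_count :: "(nat \<Rightarrow> 'a \<Rightarrow> 's::finite) \<Rightarrow> nat \<Rightarrow> 's \<Rightarrow> 's \<Rightarrow> 'a \<Rightarrow> nat" where
  "trans_count X n i j \<omega> = card {m. m < n \<and> X m \<omega> = i \<and> X (Suc m) \<omega> = j}"

definition exit_count :: "(nat \<Rightarrow> 'a \<Rightarrow> 's::finite) \<Rightarrow> nat \<Rightarrow> 's \<Rightarrow> 'a \<Rightarrow> nat" where
  "exit_count X n i \<omega> = (\<Sum>j\<in>UNIV. trans_count X n i j \<omega>)"

definition emp_trans :: "(nat \<Rightarrow> 'a \<Rightarrow> 's::finite) \<Rightarrow> nat \<Rightarrow> 'a \<Rightarrow> real ^ 's ^ 's" where
  "emp_trans X n \<omega> = (\<chi> i j. if exit_count X n i \<omega> = 0 then 0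
                              else real (trans_count X n i j \<omega>) / real (exit_count X n i \<omega>))"

section \<open>Gaussian random matrices\<close>

text \<open>Degenerate (almost surely constant) normal laws are included.\<close>

definition gaussian_rv :: "'b measure \<Rightarrow> ('b \<Rightarrow> real) \<Rightarrow> bool" where
  "gaussian_rv N Z \<longleftrightarrow> Z \<in> borel_measurable N \<and>
     ((\<exists>\<mu>. AE \<omega> in N. Z \<omega> = \<mu>) \<or>
      (\<exists>\<mu> \<sigma>. 0 < \<sigma> \<and> distributed N lborel Z (\<lambda>x. ennreal (normal_density \<mu> \<sigma> x))))"

definition gaussian_vec :: "'b measure \<Rightarrow> ('b \<Rightarrow> 'v::euclidean_space) \<Rightarrow> bool" where
  "gaussian_vec N Z \<longleftrightarrow> Z \<in> borel_measurable N \<and> (\<forall>u. gaussian_rv N (\<lambda>\<omega>. u \<bullet> Z \<omega>))"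

definition covariance :: "'b measure \<Rightarrow> ('b \<Rightarrow> real) \<Rightarrow> ('b \<Rightarrow> real) \<Rightarrow> real" where
  "covariance N Y Z =
     (LINT \<omega>|N. (Y \<omega> - (LINT \<omega>|N. Y \<omega>)) * (Z \<omega> - (LINT \<omega>|N. Z \<omega>)))"

definition limit_matrix ::
  "real ^ 's::finite ^ 's \<Rightarrow> real ^ 's \<Rightarrow> 'b measure \<Rightarrow> ('b \<Rightarrow> real ^ 's ^ 's) \<Rightarrow> bool" where
  "limit_matrix P \<pi> N W \<longleftrightarrow> prob_space N \<and> gaussian_vec N W \<and>
     (\<forall>i j. (LINT \<omega>|N. W \<omega> $ i $ j) = 0) \<and>
     (\<forall>i j k l. covariance N (\<lambda>\<omega>. W \<omega> $ i $ j) (\<lambda>\<omega>. W \<omega> $ k $ l) =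
        (if i = k then 1 / \<pi> $ i * P $ i $ j * ((if j = l then 1 else 0) - P $ i $ l) else 0))"

text \<open>\<open>W_pow P W k\<close> is \<open>\<Sum>\<^sub>i\<^sub><\<^sub>k P\<^sup>i W P\<^sup>k\<^sup>-\<^sup>1\<^sup>-\<^sup>i\<close>; the sum is empty, hence zero, for \<open>k = 0\<close>.\<close>

definition W_pow :: "real ^ 's::finite ^ 's \<Rightarrow> real ^ 's ^ 's \<Rightarrow> nat \<Rightarrow> real ^ 's ^ 's" where
  "W_pow P W k = (\<Sum>i<k. matpow P i ** W ** matpow P (k - 1 - i))"

section \<open>Failure intensities\<close>

text \<open>The row-column product \<open>a P\<^sup>k\<^sup>-\<^sup>1 J\<^sub>U P e\<^sub>D\<close>, meant for \<open>k \<ge> 1\<close>.\<close>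

definition rocof :: "real ^ 's::finite \<Rightarrow> 's set \<Rightarrow> 's set \<Rightarrow> nat \<Rightarrow> real ^ 's ^ 's \<Rightarrow> real" where
  "rocof a U D k P = (a v* (matpow P (k - 1) ** ind_diag U ** P)) \<bullet> ind_vec D"

end

theory Submission
  imports Defs
begin

text \<open>
  Near \<open>P\<close>, both estimators are differentiable functions of the empirical transition
  matrix \<open>Phat\<close>, so everything rests on the joint fluctuations of \<open>Phat\<close> around \<open>P\<close>.

  On the event that state \<open>i\<close> has been left, the error \<open>Phat\<^sub>i\<^sub>j - P\<^sub>i\<^sub>j\<close> is the sum over the steps
  out of \<open>i\<close> of the centred indicators \<open>1[next state is j] - P\<^sub>i\<^sub>j\<close>, divided by the number of
  such steps.  That number is asymptotic to \<open>n \<pi>\<^sub>i\<close> (\<open>occupation_lln\<close>), so a linear functional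
  \<open>C \<bullet> (Phat - P)\<close> is, up to an error of smaller order, \<open>1 / n\<close> times a sum
  \<open>\<Sum>\<^sub>m\<^sub><\<^sub>n g(X\<^sub>m, X\<^sub>m\<^sub>+\<^sub>1)\<close> with \<open>\<Sum>\<^sub>j P\<^sub>i\<^sub>j g(i, j) = 0\<close>.  Such sums have martingale increments;
  their second moment is at most linear in \<open>n\<close>, which gives both the law of large numbers and
  the tightness of the fluctuations.

  The central limit theorem for these sums (\<open>char_path_sum_tendsto\<close>) comes from the
  operator with entries \<open>P\<^sub>i\<^sub>j exp(\<i> \<theta> g(i, j))\<close>, whose powers give the characteristic
  function.  If \<open>v(i) = \<Sum>\<^sub>j P\<^sub>i\<^sub>j g(i, j)\<^sup>2\<close> is the conditional variance, \<open>\<sigma>\<^sup>2 = \<Sum>\<^sub>i \<pi>\<^sub>i v(i)\<close> its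
  stationary mean and \<open>h\<close> solves the Poisson equation \<open>v - \<sigma>\<^sup>2 = h - P h\<close>, then
  \<open>1 - \<theta>\<^sup>2 h / 2\<close> is an eigenfunction for the eigenvalue \<open>1 - \<theta>\<^sup>2 \<sigma>\<^sup>2 / 2\<close> with an error of order
  \<open>\<theta>\<^sup>3\<close>.  With \<open>\<theta> = t / sqrt n\<close> the \<open>n\<close> errors add up to order \<open>1 / sqrt n\<close>, and
  \<open>(1 - t\<^sup>2 \<sigma>\<^sup>2 / (2 n))\<^sup>n\<close> tends to the Gaussian characteristic function.

  For \<open>g(i, j) = (C\<^sub>i\<^sub>j - \<Sum>\<^sub>l P\<^sub>i\<^sub>l C\<^sub>i\<^sub>l) / \<pi>\<^sub>i\<close> the number \<open>\<sigma>\<^sup>2\<close> is the variance of \<open>C \<bullet> W\<close>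
  (\<open>limit_matrix_moments\<close>).  As \<open>C \<bullet> W\<close> is a centred Gaussian variable, Levy's continuity
  theorem and a Slutsky argument give the delta method \<open>delta_method_emp_trans\<close>.  It is
  applied to the two derivatives: that of \<open>rocof\<close>, by the product rule
  (\<open>has_derivative_rocof\<close>), and that of the stationary vector as a function of the matrix, by
  the resolvent identity (\<open>stationary_vec_perturbation\<close>).
\<close>

section \<open>One-step expectations along a path\<close>

context finite_markov_chain
begin

text \<open>A function of \<open>X\<^sub>0, \<dots>, X\<^sub>m\<close> factors through the history restricted to \<open>{..m}\<close>, which takes
  only finitely many values.\<close>

lemma measurable_path_functional:
  fixes \<phi> :: "(nat \<Rightarrow> 's) \<Rightarrow> 'b::topological_space"
  assumes dep: "\<And>x y. (\<And>l. l \<le> m \<Longrightarrow> x l = y l) \<Longrightarrow> \<phi> x = \<phi> y"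
  shows "(\<lambda>\<omega>. \<phi> (\<lambda>l. X l \<omega>)) \<in> borel_measurable M"
proof -
  let ?H = "\<lambda>\<omega>. restrict (\<lambda>l. X l \<omega>) {..m}"
  have fin: "finite (PiE {..m} (\<lambda>_. UNIV :: 's set))"
    by (intro finite_PiE) auto
  have "?H \<in> M \<rightarrow>\<^sub>M count_space (PiE {..m} (\<lambda>_. UNIV))"
  proof (subst measurable_count_space_eq2[OF fin], intro conjI ballI)
    show "?H \<in> space M \<rightarrow> (PiE {..m} (\<lambda>_. UNIV))"
      by auto
    fix x :: "nat \<Rightarrow> 's" assume x: "x \<in> PiE {..m} (\<lambda>_. UNIV)"
    have "?H -` {x} \<inter> space M = {\<omega> \<in> space M. \<forall>l\<in>{..m}. X l \<omega> = x l}"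
      using x by (auto simp: fun_eq_iff restrict_def PiE_def extensional_def)
    also have "\<dots> \<in> sets M"
      using measurable_X by measurable
    finally show "?H -` {x} \<inter> space M \<in> sets M" .
  qed
  then have "(\<lambda>\<omega>. \<phi> (?H \<omega>)) \<in> borel_measurable M"
    by (rule measurable_compose) simp
  moreover have "\<phi> (?H \<omega>) = \<phi> (\<lambda>l. X l \<omega>)" for \<omega>
    by (rule dep) simp
  ultimately show ?thesis
    by simp
qed

lemma integrable_path_functional:
  fixes \<phi> :: "(nat \<Rightarrow> 's) \<Rightarrow> 'b::{banach, second_countable_topology}"
  assumes dep: "\<And>x y. (\<And>l. l \<le> m \<Longrightarrow> x l = y l) \<Longrightarrow> \<phi> x = \<phi> y"
  shows "integrable M (\<lambda>\<omega>. \<phi> (\<lambda>l. X l \<omega>))"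
proof -
  let ?S = "PiE {..m} (\<lambda>_. UNIV :: 's set)"
  have fin: "finite ?S"
    by (intro finite_PiE) auto
  have "norm (\<phi> (\<lambda>l. X l \<omega>)) \<le> (\<Sum>x\<in>?S. norm (\<phi> x))" for \<omega>
  proof -
    have "norm (\<phi> (restrict (\<lambda>l. X l \<omega>) {..m})) \<le> (\<Sum>x\<in>?S. norm (\<phi> x))"
      by (rule member_le_sum[OF _ _ fin]) (auto simp del: restrict_apply)
    moreover have "\<phi> (restrict (\<lambda>l. X l \<omega>) {..m}) = \<phi> (\<lambda>l. X l \<omega>)"
      by (rule dep) simp
    ultimately show ?thesis by simp
  qed
  then show ?thesis
    by (intro integrable_const_bound measurable_path_functional[OF dep]) auto
qed

lemma integral_indicator_sum:
  fixes c :: "'i \<Rightarrow> 'b::{banach, second_countable_topology}"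
  assumes "finite I" and "\<And>i. A i \<in> sets M"
  shows "(LINT \<omega>|M. (\<Sum>i\<in>I. indicator (A i) \<omega> *\<^sub>R c i)) = (\<Sum>i\<in>I. measure M (A i) *\<^sub>R c i)"
  by (subst Bochner_Integration.integral_sum) (use assms in \<open>auto simp: emeasure_eq_measure\<close>)

lemma integral_sum_indicator_sum:
  fixes c :: "'i \<Rightarrow> 'j \<Rightarrow> 'b::{banach, second_countable_topology}"
  assumes "finite I" and "finite J" and "\<And>i j. A i j \<in> sets M"
  shows "(LINT \<omega>|M. (\<Sum>i\<in>I. \<Sum>j\<in>J. indicator (A i j) \<omega> *\<^sub>R c i j))
       = (\<Sum>i\<in>I. \<Sum>j\<in>J. measure M (A i j) *\<^sub>R c i j)"
proof -
  have "(LINT \<omega>|M. (\<Sum>i\<in>I. \<Sum>j\<in>J. indicator (A i j) \<omega> *\<^sub>R c i j))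
      = (\<Sum>i\<in>I. LINT \<omega>|M. (\<Sum>j\<in>J. indicator (A i j) \<omega> *\<^sub>R c i j))"
    by (rule Bochner_Integration.integral_sum, rule Bochner_Integration.integrable_sum)
       (use assms in \<open>auto simp: emeasure_eq_measure\<close>)
  also have "\<dots> = (\<Sum>i\<in>I. \<Sum>j\<in>J. measure M (A i j) *\<^sub>R c i j)"
    by (intro sum.cong refl integral_indicator_sum assms)
  finally show ?thesis .
qed

lemma sets_path_event: "{\<omega> \<in> space M. \<forall>l\<le>m. X l \<omega> = x l} \<in> sets M"
proof -
  have "{\<omega> \<in> space M. \<forall>l\<in>{..m}. X l \<omega> = x l} \<in> sets M"
    using measurable_X by measurable
  then show ?thesis
    unfolding Ball_def atMost_iff .
qed

text \<open>The Markov property in product form.  Unlike the conditional form it also covers histories of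
  probability zero, so sums over all histories need no case distinction.\<close>

lemma prob_path_Suc:
  "\<P>(\<omega> in M. (\<forall>l\<le>m. X l \<omega> = x l) \<and> X (Suc m) \<omega> = j)
     = \<P>(\<omega> in M. \<forall>l\<le>m. X l \<omega> = x l) * P $ x m $ j"
proof -
  note ev = sets_path_event[of m x]
  show ?thesis
  proof (cases "\<P>(\<omega> in M. \<forall>l\<le>m. X l \<omega> = x l) = 0")
    case True
    have "\<P>(\<omega> in M. (\<forall>l\<le>m. X l \<omega> = x l) \<and> X (Suc m) \<omega> = j)
        \<le> \<P>(\<omega> in M. \<forall>l\<le>m. X l \<omega> = x l)"
      by (rule finite_measure_mono[OF _ ev]) auto
    with True show ?thesis
      by (simp add: measure_le_0_iff)
  next
    case False
    then have "0 < \<P>(\<omega> in M. \<forall>l\<le>m. X l \<omega> = x l)"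
      by (simp add: zero_less_measure_iff)
    from markov[OF this, of j] False show ?thesis
      by (simp add: cond_prob_def field_simps conj_commute)
  qed
qed

text \<open>The tower property for the \<open>\<sigma>\<close>-algebra of the past: the state \<open>X\<^sub>m\<^sub>+\<^sub>1\<close> is averaged with weights
  \<open>P $ X m \<omega> $ j\<close>.  Summing over the finitely many histories reduces it to \<open>prob_path_Suc\<close> and
  replaces conditional expectations throughout.\<close>

lemma integral_markov:
  fixes \<phi> :: "(nat \<Rightarrow> 's) \<Rightarrow> 's \<Rightarrow> 'b::{banach, second_countable_topology}"
  assumes dep: "\<And>x y j. (\<And>l. l \<le> m \<Longrightarrow> x l = y l) \<Longrightarrow> \<phi> x j = \<phi> y j"
  shows "(LINT \<omega>|M. \<phi> (\<lambda>l. X l \<omega>) (X (Suc m) \<omega>))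
       = (LINT \<omega>|M. (\<Sum>j\<in>UNIV. P $ X m \<omega> $ j *\<^sub>R \<phi> (\<lambda>l. X l \<omega>) j))"
proof -
  let ?S = "PiE {..m} (\<lambda>_. UNIV :: 's set)"
  let ?E = "\<lambda>x. {\<omega> \<in> space M. \<forall>l\<le>m. X l \<omega> = x l}"
  let ?F = "\<lambda>x j. {\<omega> \<in> space M. (\<forall>l\<le>m. X l \<omega> = x l) \<and> X (Suc m) \<omega> = j}"
  have fin: "finite ?S"
    by (intro finite_PiE) auto
  note evE = sets_path_event[of m]
  have evF: "?F x j \<in> sets M" for x j
  proof -
    have A: "{\<omega> \<in> space M. X (Suc m) \<omega> = j} \<in> sets M"
      using measurable_X by measurable
    have eq: "?F x j = ?E x \<inter> {\<omega> \<in> space M. X (Suc m) \<omega> = j}"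
      by auto
    show ?thesis
      by (subst eq) (rule sets.Int[OF evE A])
  qed
  have split: "\<psi> (\<lambda>l. X l \<omega>) = (\<Sum>x\<in>?S. indicator (?E x) \<omega> *\<^sub>R \<psi> x)"
    if "\<omega> \<in> space M" and "\<And>x y. (\<And>l. l \<le> m \<Longrightarrow> x l = y l) \<Longrightarrow> \<psi> x = \<psi> y"
    for \<omega> and \<psi> :: "(nat \<Rightarrow> 's) \<Rightarrow> 'b"
  proof -
    let ?x0 = "restrict (\<lambda>l. X l \<omega>) {..m}"
    have "(\<Sum>x\<in>?S. indicator (?E x) \<omega> *\<^sub>R \<psi> x) = (\<Sum>x\<in>{?x0}. indicator (?E x) \<omega> *\<^sub>R \<psi> x)"
    proof (rule sum.mono_neutral_right[OF fin])
      show "\<forall>x\<in>?S - {?x0}. indicator (?E x) \<omega> *\<^sub>R \<psi> x = 0"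
      proof
        fix x assume x: "x \<in> ?S - {?x0}"
        have "x = ?x0" if "\<forall>l\<le>m. X l \<omega> = x l"
          using x that by (intro PiE_ext[of x "{..m}" "\<lambda>_. UNIV"]) auto
        then have "\<omega> \<notin> ?E x"
          using x by blast
        then show "indicator (?E x) \<omega> *\<^sub>R \<psi> x = 0"
          by simp
      qed
    qed (simp_all del: restrict_apply)
    also have "\<dots> = \<psi> ?x0"
      using that(1) by simp
    also have "\<dots> = \<psi> (\<lambda>l. X l \<omega>)"
      by (rule that(2)) simp
    finally show ?thesis by simp
  qed
  have "(LINT \<omega>|M. \<phi> (\<lambda>l. X l \<omega>) (X (Suc m) \<omega>))
      = (LINT \<omega>|M. (\<Sum>x\<in>?S. \<Sum>j\<in>UNIV. indicator (?F x j) \<omega> *\<^sub>R \<phi> x j))"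
  proof (rule Bochner_Integration.integral_cong[OF refl])
    fix \<omega> assume w: "\<omega> \<in> space M"
    have "\<phi> (\<lambda>l. X l \<omega>) (X (Suc m) \<omega>)
        = (\<Sum>x\<in>?S. indicator (?E x) \<omega> *\<^sub>R \<phi> x (X (Suc m) \<omega>))"
      by (rule split[OF w]) (rule dep)
    also have "\<dots> = (\<Sum>x\<in>?S. \<Sum>j\<in>UNIV. indicator (?F x j) \<omega> *\<^sub>R \<phi> x j)"
    proof (rule sum.cong[OF refl])
      fix x
      have "(\<Sum>j\<in>UNIV. indicator (?F x j) \<omega> *\<^sub>R \<phi> x j)
          = (\<Sum>j\<in>{X (Suc m) \<omega>}. indicator (?F x j) \<omega> *\<^sub>R \<phi> x j)"
        by (rule sum.mono_neutral_right) (auto simp: indicator_def)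
      then show "indicator (?E x) \<omega> *\<^sub>R \<phi> x (X (Suc m) \<omega>)
          = (\<Sum>j\<in>UNIV. indicator (?F x j) \<omega> *\<^sub>R \<phi> x j)"
        by (simp add: indicator_def)
    qed
    finally show "\<phi> (\<lambda>l. X l \<omega>) (X (Suc m) \<omega>)
        = (\<Sum>x\<in>?S. \<Sum>j\<in>UNIV. indicator (?F x j) \<omega> *\<^sub>R \<phi> x j)" .
  qed
  also have "\<dots> = (\<Sum>x\<in>?S. \<Sum>j\<in>UNIV. measure M (?F x j) *\<^sub>R \<phi> x j)"
    by (rule integral_sum_indicator_sum[OF fin finite evF])
  also have "\<dots> = (\<Sum>x\<in>?S. measure M (?E x) *\<^sub>R (\<Sum>j\<in>UNIV. P $ x m $ j *\<^sub>R \<phi> x j))"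
    by (simp only: prob_path_Suc scaleR_sum_right scaleR_scaleR)
  also have "\<dots> = (LINT \<omega>|M. (\<Sum>x\<in>?S. indicator (?E x) \<omega> *\<^sub>R (\<Sum>j\<in>UNIV. P $ x m $ j *\<^sub>R \<phi> x j)))"
    by (rule integral_indicator_sum[OF fin evE, symmetric])
  also have "\<dots> = (LINT \<omega>|M. (\<Sum>j\<in>UNIV. P $ X m \<omega> $ j *\<^sub>R \<phi> (\<lambda>l. X l \<omega>) j))"
  proof (rule Bochner_Integration.integral_cong[OF refl])
    fix \<omega> assume w: "\<omega> \<in> space M"
    define \<psi> where "\<psi> x = (\<Sum>j\<in>UNIV. P $ x m $ j *\<^sub>R \<phi> x j)" for x
    have "\<psi> x = \<psi> y" if xy: "\<And>l. l \<le> m \<Longrightarrow> x l = y l" for x y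
    proof -
      have "\<phi> x j = \<phi> y j" for j
        by (rule dep) (rule xy)
      then show ?thesis
        using xy[of m] by (simp add: \<psi>_def)
    qed
    from split[OF w, of \<psi>, OF this]
    show "(\<Sum>x\<in>?S. indicator (?E x) \<omega> *\<^sub>R (\<Sum>j\<in>UNIV. P $ x m $ j *\<^sub>R \<phi> x j))
        = (\<Sum>j\<in>UNIV. P $ X m \<omega> $ j *\<^sub>R \<phi> (\<lambda>l. X l \<omega>) j)"
      unfolding \<psi>_def by (rule sym)
  qed
  finally show ?thesis .
qed

end

section \<open>The stationary vector and the Poisson equation\<close>

text \<open>Some state \<open>k\<close> carries mass, some power of \<open>P\<close> leads from \<open>k\<close> to \<open>i\<close>, and \<open>\<pi>\<close> is invariant
  under that power.\<close>

lemma stationary_vec_pos: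
  fixes P :: "real ^ 's::finite ^ 's"
  assumes P: "stochastic_matrix P" "irreducible_matrix P" and \<pi>: "stationary_vec P \<pi>"
  shows "0 < \<pi> $ i"
proof -
  have \<pi>n: "\<pi> v* matpow P n = \<pi>" for n
    using \<pi> by (induction n) (simp_all add: vector_matrix_mul_assoc[symmetric] stationary_vec_def)
  have nn: "0 \<le> \<pi> $ k" "(\<Sum>k\<in>UNIV. \<pi> $ k) = 1" for k
    using \<pi> by (auto simp: stationary_vec_def)
  have "\<exists>k. 0 < \<pi> $ k"
  proof (rule ccontr)
    assume "\<not> ?thesis"
    then have "\<pi> $ k = 0" for k
      using nn(1)[of k] by (metis antisym_conv2)
    then show False using nn(2) by simp
  qed
  then obtain k where k: "0 < \<pi> $ k" by blast
  obtain n where n: "0 < matpow P n $ k $ i"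
    using P(2) by (auto simp: irreducible_matrix_def)
  have "0 < matpow P n $ k $ i * \<pi> $ k"
    using k n by simp
  also have "\<dots> \<le> (\<Sum>j\<in>UNIV. matpow P n $ j $ i * \<pi> $ j)"
    using stochastic_matpow[OF P(1), of n] nn
    by (intro member_le_sum) (auto simp: stochastic_matrix_def)
  also have "\<dots> = \<pi> $ i"
    using arg_cong[OF \<pi>n[of n], of "\<lambda>v. v $ i"] by (simp add: vector_matrix_mult_def mult.commute)
  finally show ?thesis .
qed

text \<open>The matrix \<open>Z = I - P + A\<close> is invertible, so \<open>Z h = v - \<pi> v\<close> has a solution.  Applying \<open>\<pi> Z = 1\<close>
  shows that the entries of \<open>h\<close> sum to zero, whence \<open>A h = 0\<close> and \<open>Z h = h - P h\<close>.\<close>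

lemma poisson_equation:
  fixes P :: "real ^ 's::finite ^ 's"
  assumes P: "stochastic_matrix P" "irreducible_matrix P" and \<pi>: "stationary_vec P \<pi>"
  obtains h :: "real ^ 's" where "\<And>i. v i = (\<Sum>k\<in>UNIV. \<pi> $ k * v k) + h $ i - (\<Sum>j\<in>UNIV. P $ i $ j * h $ j)"
proof -
  let ?Z = "mat 1 - P + all_ones"
  define c where "c = (\<Sum>k\<in>UNIV. \<pi> $ k * v k)"
  define b :: "real ^ 's" where "b = (\<chi> i. v i - c)"
  have "invertible ?Z"
    by (rule stationary_vec_formula(1)[OF P \<pi>])
  then obtain h where h: "?Z *v h = b"
    by (metis invertible_def matrix_vector_mul_assoc matrix_vector_mul_lid)
  have \<pi>1: "(\<Sum>k\<in>UNIV. \<pi> $ k) = 1"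
    using \<pi> by (simp add: stationary_vec_def)
  have ones: "\<pi> v* all_ones = 1"
    using \<pi>1 by (simp add: vec_eq_iff vector_matrix_mult_def all_ones_def)
  have \<pi>Z: "\<pi> v* ?Z = 1"
    using \<pi> ones by (simp add: stationary_vec_def vector_matrix_mult_diff_rdistrib
        vector_matrix_mult_add_rdistrib)
  have "(\<Sum>i\<in>UNIV. h $ i) = (\<pi> v* ?Z) \<bullet> h"
    by (simp add: \<pi>Z inner_vec_def)
  also have "\<dots> = \<pi> \<bullet> b"
    by (simp add: dot_lmul_matrix h)
  also have "\<dots> = 0"
    using \<pi>1 by (simp add: b_def inner_vec_def right_diff_distrib sum_subtractf
        sum_distrib_right[symmetric] c_def)
  finally have s0: "(\<Sum>i\<in>UNIV. h $ i) = 0" .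
  have "b $ i = h $ i - (\<Sum>j\<in>UNIV. P $ i $ j * h $ j)" for i
  proof -
    have "b $ i = (?Z *v h) $ i" by (simp add: h)
    also have "\<dots> = h $ i - (P *v h) $ i + (all_ones *v h) $ i"
      by (simp add: matrix_vector_mult_add_rdistrib matrix_vector_mult_diff_rdistrib)
    also have "(all_ones *v h) $ i = 0"
      using s0 by (simp add: matrix_vector_mult_def all_ones_def)
    finally show ?thesis by (simp add: matrix_vector_mult_def)
  qed
  then have "v i = c + h $ i - (\<Sum>j\<in>UNIV. P $ i $ j * h $ j)" for i
    by (simp add: b_def algebra_simps)
  then show ?thesis
    using that unfolding c_def by blast
qed

section \<open>A central limit theorem for centred sums over transitions\<close>

definition path_sum :: "('s \<Rightarrow> 's \<Rightarrow> real) \<Rightarrow> nat \<Rightarrow> (nat \<Rightarrow> 's) \<Rightarrow> real" where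
  "path_sum g n x = (\<Sum>m<n. g (x m) (x (Suc m)))"

lemma path_sum_cong:
  assumes "\<And>l. l \<le> n \<Longrightarrow> x l = y l"
  shows "path_sum g n x = path_sum g n y"
  using assms by (simp add: path_sum_def)

text \<open>The function \<open>1 - \<theta>\<^sup>2 h / 2\<close> is an approximate eigenfunction of the operator with entries
  \<open>P\<^sub>i\<^sub>j exp(\<i> \<theta> g(i, j))\<close>.  Expanding to second order, the linear term vanishes by centring and the
  quadratic terms combine to \<open>- \<theta>\<^sup>2 (v + P h) / 2\<close>, which the Poisson equation turns into
  \<open>- \<theta>\<^sup>2 (\<sigma>2 + h) / 2\<close>: exactly the quadratic part of
  \<open>(1 - \<theta>\<^sup>2 \<sigma>2 / 2) (1 - \<theta>\<^sup>2 h / 2)\<close>.\<close>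

lemma twisted_operator_approx:
  fixes P :: "real ^ 's::finite ^ 's" and g :: "'s \<Rightarrow> 's \<Rightarrow> real" and h :: "'s \<Rightarrow> real"
  assumes P: "stochastic_matrix P"
    and centred: "(\<Sum>j\<in>UNIV. P $ i $ j * g i j) = 0"
    and poisson: "(\<Sum>j\<in>UNIV. P $ i $ j * (g i j)\<^sup>2) = \<sigma>2 + h i - (\<Sum>j\<in>UNIV. P $ i $ j * h j)"
    and G: "\<And>j. \<bar>g i j\<bar> \<le> G" and H: "\<And>j. \<bar>h j\<bar> \<le> H"
    and \<theta>: "\<bar>\<theta>\<bar> \<le> 1" and \<sigma>2: "0 \<le> \<sigma>2"
  shows "norm ((\<Sum>j\<in>UNIV. P $ i $ j *\<^sub>R (iexp (\<theta> * g i j) * of_real (1 - \<theta>\<^sup>2 / 2 * h j)))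
            - of_real ((1 - \<theta>\<^sup>2 / 2 * \<sigma>2) * (1 - \<theta>\<^sup>2 / 2 * h i))) \<le> (G ^ 3 + G * H + \<sigma>2 * H) * \<bar>\<theta>\<bar> ^ 3"
proof -
  have P0: "0 \<le> P $ i $ j" and P1: "(\<Sum>j\<in>UNIV. P $ i $ j) = 1" for j
    using P by (auto simp: stochastic_matrix_def)
  have G0: "0 \<le> G" and H0: "0 \<le> H"
    using G H abs_ge_zero order_trans by blast+
  (* Taylor remainders of third and of first order; the latter suffices next to the factor \<theta>^2. *)
  define r1 where "r1 j = iexp (\<theta> * g i j) - (1 + \<i> * of_real (\<theta> * g i j) - of_real ((\<theta> * g i j)\<^sup>2 / 2))" for j
  define r2 where "r2 j = iexp (\<theta> * g i j) - 1" for j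
  have r1: "norm (r1 j) \<le> G ^ 3 * \<bar>\<theta>\<bar> ^ 3" for j
  proof -
    have "r1 j = iexp (\<theta> * g i j) - (\<Sum>k\<le>2. (\<i> * of_real (\<theta> * g i j)) ^ k / fact k)"
      by (simp add: r1_def eval_nat_numeral algebra_simps)
    then have "norm (r1 j) \<le> \<bar>\<theta> * g i j\<bar> ^ Suc 2 / fact (Suc 2)"
      using iexp_approx1[of "\<theta> * g i j" 2] by simp
    also have "\<dots> = \<bar>\<theta> * g i j\<bar> ^ 3 / 6"
      by (simp only: fact_numeral Suc_numeral) (simp add: fact_numeral)
    also have "\<dots> \<le> \<bar>\<theta> * g i j\<bar> ^ 3"
      using zero_le_power[OF abs_ge_zero[of "\<theta> * g i j"], of 3] by linarith
    also have "\<dots> \<le> (\<bar>\<theta>\<bar> * G) ^ 3"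
      unfolding abs_mult by (intro power_mono mult_left_mono G) auto
    finally show ?thesis by (simp add: power_mult_distrib mult.commute)
  qed
  have r2: "norm (r2 j) \<le> G * \<bar>\<theta>\<bar>" for j
  proof -
    have "norm (r2 j) \<le> \<bar>\<theta> * g i j\<bar>"
      using iexp_approx1[of "\<theta> * g i j" 0] by (simp add: r2_def)
    also have "\<dots> \<le> \<bar>\<theta>\<bar> * G"
      unfolding abs_mult by (intro mult_left_mono G) auto
    finally show ?thesis by (simp add: mult.commute)
  qed
  have expand: "iexp (\<theta> * g i j) * of_real (1 - \<theta>\<^sup>2 / 2 * h j)
      = (1 + \<i> * of_real (\<theta> * g i j) - of_real ((\<theta> * g i j)\<^sup>2 / 2) - of_real (\<theta>\<^sup>2 / 2 * h j))
        + (r1 j - of_real (\<theta>\<^sup>2 / 2 * h j) * r2 j)" for j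
  proof -
    have "e * of_real (1 - c) = (A - of_real c) + ((e - A) - of_real c * (e - 1))" for e A :: complex and c
      by (simp add: algebra_simps)
    then show ?thesis
      unfolding r1_def r2_def .
  qed
  have main: "(\<Sum>j\<in>UNIV. P $ i $ j *\<^sub>R (1 + \<i> * of_real (\<theta> * g i j) - of_real ((\<theta> * g i j)\<^sup>2 / 2)
      - of_real (\<theta>\<^sup>2 / 2 * h j))) = of_real (1 - \<theta>\<^sup>2 / 2 * (\<sigma>2 + h i))" (is "?m = _")
  proof -
    have "?m = of_real (\<Sum>j\<in>UNIV. P $ i $ j) + \<i> * of_real (\<theta> * (\<Sum>j\<in>UNIV. P $ i $ j * g i j))
       - of_real (\<theta>\<^sup>2 / 2 * (\<Sum>j\<in>UNIV. P $ i $ j * (g i j)\<^sup>2)) - of_real (\<theta>\<^sup>2 / 2 * (\<Sum>j\<in>UNIV. P $ i $ j * h j))"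
      unfolding sum_distrib_left of_real_sum
      by (simp add: sum.distrib sum_subtractf scaleR_conv_of_real algebra_simps power_mult_distrib)
    also have "\<dots> = of_real (1 - \<theta>\<^sup>2 / 2 * (\<sigma>2 + h i))"
      unfolding centred poisson P1 by (simp add: algebra_simps)
    finally show ?thesis .
  qed
  have rest: "norm (\<Sum>j\<in>UNIV. P $ i $ j *\<^sub>R (r1 j - of_real (\<theta>\<^sup>2 / 2 * h j) * r2 j))
      \<le> G ^ 3 * \<bar>\<theta>\<bar> ^ 3 + G * H / 2 * \<bar>\<theta>\<bar> ^ 3"
  proof -
    have "norm (r1 j - of_real (\<theta>\<^sup>2 / 2 * h j) * r2 j) \<le> G ^ 3 * \<bar>\<theta>\<bar> ^ 3 + G * H / 2 * \<bar>\<theta>\<bar> ^ 3" for j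
    proof -
      have "norm (of_real (\<theta>\<^sup>2 / 2 * h j) * r2 j) = \<theta>\<^sup>2 / 2 * \<bar>h j\<bar> * norm (r2 j)"
        unfolding norm_mult norm_of_real by (simp add: abs_mult)
      also have "\<dots> \<le> \<theta>\<^sup>2 / 2 * H * (G * \<bar>\<theta>\<bar>)"
        by (intro mult_mono r2 H mult_nonneg_nonneg H0) auto
      also have "\<dots> = G * H / 2 * \<bar>\<theta>\<bar> ^ 3"
        by (simp add: eval_nat_numeral)
      finally show ?thesis
        using r1[of j] norm_triangle_ineq4[of "r1 j" "of_real (\<theta>\<^sup>2 / 2 * h j) * r2 j"] by linarith
    qed
    then have "norm (\<Sum>j\<in>UNIV. P $ i $ j *\<^sub>R (r1 j - of_real (\<theta>\<^sup>2 / 2 * h j) * r2 j))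
       \<le> (\<Sum>j\<in>UNIV. P $ i $ j * (G ^ 3 * \<bar>\<theta>\<bar> ^ 3 + G * H / 2 * \<bar>\<theta>\<bar> ^ 3))"
      using P0 by (intro sum_norm_le) (simp add: mult_left_mono)
    then show ?thesis
      using P1 by (simp add: sum_distrib_right[symmetric])
  qed
  have eq: "(\<Sum>j\<in>UNIV. P $ i $ j *\<^sub>R (iexp (\<theta> * g i j) * of_real (1 - \<theta>\<^sup>2 / 2 * h j)))
            - of_real ((1 - \<theta>\<^sup>2 / 2 * \<sigma>2) * (1 - \<theta>\<^sup>2 / 2 * h i))
      = (\<Sum>j\<in>UNIV. P $ i $ j *\<^sub>R (r1 j - of_real (\<theta>\<^sup>2 / 2 * h j) * r2 j)) - of_real (\<theta> ^ 4 / 4 * \<sigma>2 * h i)"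
    unfolding expand scaleR_add_right sum.distrib main
    by (simp add: algebra_simps power2_eq_square power4_eq_xxxx)
  have n4: "norm (of_real (\<theta> ^ 4 / 4 * \<sigma>2 * h i) :: complex) \<le> \<sigma>2 * H * \<bar>\<theta>\<bar> ^ 3"
  proof -
    have "\<bar>\<theta> ^ 4\<bar> \<le> \<bar>\<theta>\<bar> ^ 3"
      unfolding power_abs using \<theta> by (intro power_decreasing) auto
    moreover have "0 \<le> \<bar>\<theta>\<bar> ^ 3"
      by simp
    ultimately have "\<bar>\<theta> ^ 4 / 4\<bar> \<le> \<bar>\<theta>\<bar> ^ 3"
      unfolding abs_divide by linarith
    then have "\<bar>\<theta> ^ 4 / 4\<bar> * \<sigma>2 * \<bar>h i\<bar> \<le> \<bar>\<theta>\<bar> ^ 3 * \<sigma>2 * H"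
      by (intro mult_mono H \<sigma>2) (auto simp: \<sigma>2)
    then show ?thesis
      using \<sigma>2 by (simp only: norm_of_real abs_mult abs_of_nonneg) (simp add: mult_ac)
  qed
  have "norm ((\<Sum>j\<in>UNIV. P $ i $ j *\<^sub>R (iexp (\<theta> * g i j) * of_real (1 - \<theta>\<^sup>2 / 2 * h j)))
            - of_real ((1 - \<theta>\<^sup>2 / 2 * \<sigma>2) * (1 - \<theta>\<^sup>2 / 2 * h i)))
       \<le> G ^ 3 * \<bar>\<theta>\<bar> ^ 3 + G * H / 2 * \<bar>\<theta>\<bar> ^ 3 + \<sigma>2 * H * \<bar>\<theta>\<bar> ^ 3"
    unfolding eq by (rule order_trans[OF norm_triangle_ineq4 add_mono[OF rest n4]])
  also have "\<dots> \<le> (G ^ 3 + G * H + \<sigma>2 * H) * \<bar>\<theta>\<bar> ^ 3"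
    using G0 H0 by (simp add: distrib_right)
  finally show ?thesis .
qed

lemma (in prob_space) norm_integral_le_const:
  fixes f :: "'a \<Rightarrow> 'b::{banach, second_countable_topology}"
  assumes "integrable M f" and "\<And>\<omega>. norm (f \<omega>) \<le> c"
  shows "norm (LINT \<omega>|M. f \<omega>) \<le> c"
proof -
  have "norm (LINT \<omega>|M. f \<omega>) \<le> (LINT \<omega>|M. norm (f \<omega>))"
    by (rule integral_norm_bound)
  also have "\<dots> \<le> c"
    using assms by (intro integral_le_const) auto
  finally show ?thesis .
qed

context finite_markov_chain
begin

text \<open>The increments are orthogonal to the past, so the cross terms in the square of the sum have mean
  zero.\<close>

lemma second_moment_path_sum:
  assumes centred: "\<And>i. (\<Sum>j\<in>UNIV. P $ i $ j * g i j) = 0" and G: "\<And>i j. \<bar>g i j\<bar> \<le> G"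
  shows "(LINT \<omega>|M. (path_sum g n (\<lambda>l. X l \<omega>))\<^sup>2) \<le> n * G\<^sup>2"
proof (induction n)
  case 0
  then show ?case by (simp add: path_sum_def)
next
  case (Suc n)
  let ?S = "\<lambda>\<omega>. path_sum g n (\<lambda>l. X l \<omega>)"
  let ?g = "\<lambda>\<omega>. g (X n \<omega>) (X (Suc n) \<omega>)"
  have int: "integrable M (\<lambda>\<omega>. (?S \<omega>)\<^sup>2)"
    by (rule integrable_path_functional[where m=n and \<phi>="\<lambda>x. (path_sum g n x)\<^sup>2"])
       (simp add: path_sum_def)
  have int2: "integrable M (\<lambda>\<omega>. ?S \<omega> * ?g \<omega>)"
    by (rule integrable_path_functional[where m="Suc n" and \<phi>="\<lambda>x. path_sum g n x * g (x n) (x (Suc n))"])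
       (simp add: path_sum_def)
  have int3: "integrable M (\<lambda>\<omega>. (?g \<omega>)\<^sup>2)"
    by (rule integrable_path_functional[where m="Suc n" and \<phi>="\<lambda>x. (g (x n) (x (Suc n)))\<^sup>2"]) simp
  have "(LINT \<omega>|M. ?S \<omega> * ?g \<omega>)
      = (LINT \<omega>|M. (\<Sum>j\<in>UNIV. P $ X n \<omega> $ j *\<^sub>R (?S \<omega> * g (X n \<omega>) j)))"
    by (rule integral_markov[where m=n and \<phi>="\<lambda>x j. path_sum g n x * g (x n) j"])
       (simp add: path_sum_def)
  also have "\<dots> = (LINT \<omega>|M. ?S \<omega> * (\<Sum>j\<in>UNIV. P $ X n \<omega> $ j * g (X n \<omega>) j))"
    by (simp add: sum_distrib_left mult_ac)
  also have "\<dots> = 0"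
    by (simp add: centred)
  finally have orth: "(LINT \<omega>|M. ?S \<omega> * ?g \<omega>) = 0" .
  have g2: "(LINT \<omega>|M. (?g \<omega>)\<^sup>2) \<le> G\<^sup>2"
    by (rule integral_le_const[OF int3]) (use G in \<open>auto intro!: AE_I2 abs_le_square_iff[THEN iffD1] order_trans[OF G abs_ge_self]\<close>)
  have "(LINT \<omega>|M. (path_sum g (Suc n) (\<lambda>l. X l \<omega>))\<^sup>2)
      = (LINT \<omega>|M. (?S \<omega>)\<^sup>2 + 2 * (?S \<omega> * ?g \<omega>) + (?g \<omega>)\<^sup>2)"
    by (rule Bochner_Integration.integral_cong) (simp_all add: path_sum_def power2_sum algebra_simps)
  also have "\<dots> = (LINT \<omega>|M. (?S \<omega>)\<^sup>2) + (LINT \<omega>|M. (?g \<omega>)\<^sup>2)"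
    using int int2 int3 orth by simp
  also have "\<dots> \<le> real (Suc n) * G\<^sup>2"
    using Suc g2 by (simp add: algebra_simps)
  finally show ?case .
qed

lemma prob_path_sum_ge:
  assumes centred: "\<And>i. (\<Sum>j\<in>UNIV. P $ i $ j * g i j) = 0" and G: "\<And>i j. \<bar>g i j\<bar> \<le> G" and c: "0 < c"
  shows "\<P>(\<omega> in M. c \<le> \<bar>path_sum g n (\<lambda>l. X l \<omega>)\<bar>) \<le> n * G\<^sup>2 / c\<^sup>2"
proof -
  have "\<P>(\<omega> in M. c \<le> \<bar>path_sum g n (\<lambda>l. X l \<omega>)\<bar>) \<le> (LINT \<omega>|M. (path_sum g n (\<lambda>l. X l \<omega>))\<^sup>2) / c\<^sup>2"
  proof (rule second_moment_method[OF _ _ c])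
    show "integrable M (\<lambda>\<omega>. (path_sum g n (\<lambda>l. X l \<omega>))\<^sup>2)"
      by (rule integrable_path_functional[where m=n and \<phi>="\<lambda>x. (path_sum g n x)\<^sup>2"])
         (simp add: path_sum_def)
    show "random_variable borel (\<lambda>\<omega>. path_sum g n (\<lambda>l. X l \<omega>))"
      by (rule measurable_path_functional[where m=n]) (rule path_sum_cong)
  qed
  also have "\<dots> \<le> n * G\<^sup>2 / c\<^sup>2"
    by (intro divide_right_mono second_moment_path_sum centred G) auto
  finally show ?thesis .
qed

text \<open>The expectation \<open>z n\<close> of \<open>exp (\<i> \<theta> S\<^sub>n) (1 - \<theta>\<^sup>2 h (X\<^sub>n) / 2)\<close> is almost multiplied by
  \<open>1 - \<theta>\<^sup>2 \<sigma>2 / 2\<close> in each step.  The factor in brackets differs from 1 by order \<open>\<theta>\<^sup>2\<close>, at time 0 and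
  at time \<open>n\<close>.\<close>

lemma char_path_sum_approx:
  fixes h :: "'s \<Rightarrow> real"
  assumes P: "stochastic_matrix P"
    and centred: "\<And>i. (\<Sum>j\<in>UNIV. P $ i $ j * g i j) = 0"
    and poisson: "\<And>i. (\<Sum>j\<in>UNIV. P $ i $ j * (g i j)\<^sup>2) = \<sigma>2 + h i - (\<Sum>j\<in>UNIV. P $ i $ j * h j)"
    and G: "\<And>i j. \<bar>g i j\<bar> \<le> G" and H: "\<And>j. \<bar>h j\<bar> \<le> H"
    and \<theta>: "\<bar>\<theta>\<bar> \<le> 1" and \<sigma>2: "0 \<le> \<sigma>2" and q: "\<theta>\<^sup>2 / 2 * \<sigma>2 \<le> 1"
  shows "norm ((LINT \<omega>|M. iexp (\<theta> * path_sum g n (\<lambda>l. X l \<omega>))) - of_real ((1 - \<theta>\<^sup>2 / 2 * \<sigma>2) ^ n))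
           \<le> n * ((G ^ 3 + G * H + \<sigma>2 * H) * \<bar>\<theta>\<bar> ^ 3) + \<theta>\<^sup>2 * H"
proof -
  let ?q = "1 - \<theta>\<^sup>2 / 2 * \<sigma>2"
  let ?K = "(G ^ 3 + G * H + \<sigma>2 * H) * \<bar>\<theta>\<bar> ^ 3"
  let ?e = "\<lambda>n \<omega>. iexp (\<theta> * path_sum g n (\<lambda>l. X l \<omega>))"
  (* The expectation that the approximate eigenfunction makes nearly geometric in n. *)
  define z where "z n = (LINT \<omega>|M. ?e n \<omega> * of_real (1 - \<theta>\<^sup>2 / 2 * h (X n \<omega>)))" for n
  have intz: "integrable M (\<lambda>\<omega>. ?e n \<omega> * of_real (1 - \<theta>\<^sup>2 / 2 * h (X n \<omega>)))" for n
    by (rule integrable_path_functional[where m=n and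
          \<phi>="\<lambda>x. iexp (\<theta> * path_sum g n x) * of_real (1 - \<theta>\<^sup>2 / 2 * h (x n))"])
       (simp add: path_sum_def)
  have inte: "integrable M (?e n)" for n
    by (rule integrable_path_functional[where m=n and \<phi>="\<lambda>x. iexp (\<theta> * path_sum g n x)"])
       (simp add: path_sum_def)
  let ?T = "\<lambda>i. \<Sum>j\<in>UNIV. P $ i $ j *\<^sub>R (iexp (\<theta> * g i j) * of_real (1 - \<theta>\<^sup>2 / 2 * h j))"
  have alg: "e * (T - of_real (a * b)) = e * T - of_real a * (e * of_real b)" for e T :: complex and a b
    by (simp add: algebra_simps)
  have step: "norm (z (Suc n) - of_real ?q * z n) \<le> ?K" for n
  proof -
    have "z (Suc n) = (LINT \<omega>|M. ?e n \<omega> * iexp (\<theta> * g (X n \<omega>) (X (Suc n) \<omega>)) * of_real (1 - \<theta>\<^sup>2 / 2 * h (X (Suc n) \<omega>)))"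
      unfolding z_def
      by (rule Bochner_Integration.integral_cong) (simp_all add: path_sum_def algebra_simps exp_add)
    also have "\<dots> = (LINT \<omega>|M. (\<Sum>j\<in>UNIV. P $ X n \<omega> $ j *\<^sub>R (?e n \<omega> * iexp (\<theta> * g (X n \<omega>) j) * of_real (1 - \<theta>\<^sup>2 / 2 * h j))))"
      by (rule integral_markov[where m=n and \<phi>="\<lambda>x j. iexp (\<theta> * path_sum g n x) * iexp (\<theta> * g (x n) j) * of_real (1 - \<theta>\<^sup>2 / 2 * h j)"])
         (simp add: path_sum_def)
    also have "\<dots> = (LINT \<omega>|M. ?e n \<omega> * ?T (X n \<omega>))"
      by (simp add: sum_distrib_left mult.assoc)
    finally have zS: "z (Suc n) = (LINT \<omega>|M. ?e n \<omega> * ?T (X n \<omega>))" .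
    have intT: "integrable M (\<lambda>\<omega>. ?e n \<omega> * ?T (X n \<omega>))"
      by (rule integrable_path_functional[where m=n and \<phi>="\<lambda>x. iexp (\<theta> * path_sum g n x) * ?T (x n)"])
         (simp add: path_sum_def)
    have "z (Suc n) - of_real ?q * z n
        = (LINT \<omega>|M. ?e n \<omega> * (?T (X n \<omega>) - of_real (?q * (1 - \<theta>\<^sup>2 / 2 * h (X n \<omega>)))))"
    proof -
      have "(LINT \<omega>|M. ?e n \<omega> * (?T (X n \<omega>) - of_real (?q * (1 - \<theta>\<^sup>2 / 2 * h (X n \<omega>)))))
        = (LINT \<omega>|M. ?e n \<omega> * ?T (X n \<omega>) - of_real ?q * (?e n \<omega> * of_real (1 - \<theta>\<^sup>2 / 2 * h (X n \<omega>))))"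
        by (simp only: alg)
      also have "\<dots> = z (Suc n) - of_real ?q * z n"
        unfolding zS z_def[of n]
        by (subst Bochner_Integration.integral_diff)
           (simp_all only: intT intz integrable_mult_right integral_mult_right_zero)
      finally show ?thesis ..
    qed
    also have "norm \<dots> \<le> ?K"
    proof (rule norm_integral_le_const)
      show "integrable M (\<lambda>\<omega>. ?e n \<omega> * (?T (X n \<omega>) - of_real (?q * (1 - \<theta>\<^sup>2 / 2 * h (X n \<omega>)))))"
        by (rule integrable_path_functional[where m=n and
             \<phi>="\<lambda>x. iexp (\<theta> * path_sum g n x) * (?T (x n) - of_real (?q * (1 - \<theta>\<^sup>2 / 2 * h (x n))))"])
           (simp add: path_sum_def)
      fix \<omega>
      show "norm (?e n \<omega> * (?T (X n \<omega>) - of_real (?q * (1 - \<theta>\<^sup>2 / 2 * h (X n \<omega>))))) \<le> ?K"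
        unfolding norm_mult norm_exp_i_times mult_1
        by (rule twisted_operator_approx[OF P centred poisson G H \<theta> \<sigma>2])
    qed
    finally show ?thesis .
  qed
  have q1: "\<bar>?q\<bar> \<le> 1"
    using q \<sigma>2 by (auto simp: abs_le_iff)
  have zn: "norm (z n - of_real (?q ^ n) * z 0) \<le> n * ?K" for n
  proof (induction n)
    case (Suc n)
    have "z (Suc n) - of_real (?q ^ Suc n) * z 0
        = (z (Suc n) - of_real ?q * z n) + of_real ?q * (z n - of_real (?q ^ n) * z 0)"
      by (simp add: algebra_simps)
    also have "norm \<dots> \<le> ?K + \<bar>?q\<bar> * norm (z n - of_real (?q ^ n) * z 0)"
      by (rule norm_triangle_le) (simp only: norm_mult norm_of_real add_right_mono[OF step])
    also have "\<dots> \<le> ?K + 1 * (n * ?K)"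
      using Suc q1 by (intro add_left_mono mult_mono) auto
    finally show ?case by (simp add: algebra_simps)
  qed simp
  have zu: "norm (z n - (LINT \<omega>|M. ?e n \<omega>)) \<le> \<theta>\<^sup>2 / 2 * H" for n
  proof -
    have "z n - (LINT \<omega>|M. ?e n \<omega>) = (LINT \<omega>|M. ?e n \<omega> * of_real (1 - \<theta>\<^sup>2 / 2 * h (X n \<omega>)) - ?e n \<omega>)"
      unfolding z_def by (rule Bochner_Integration.integral_diff[symmetric, OF intz inte])
    also have "norm \<dots> \<le> \<theta>\<^sup>2 / 2 * H"
    proof (rule norm_integral_le_const)
      show "integrable M (\<lambda>\<omega>. ?e n \<omega> * of_real (1 - \<theta>\<^sup>2 / 2 * h (X n \<omega>)) - ?e n \<omega>)"
        by (intro Bochner_Integration.integrable_diff intz inte)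
      fix \<omega>
      have "?e n \<omega> * of_real (1 - \<theta>\<^sup>2 / 2 * h (X n \<omega>)) - ?e n \<omega> = ?e n \<omega> * of_real (- (\<theta>\<^sup>2 / 2 * h (X n \<omega>)))"
        by (simp add: algebra_simps)
      also have "norm \<dots> = \<theta>\<^sup>2 / 2 * \<bar>h (X n \<omega>)\<bar>"
        unfolding norm_mult norm_exp_i_times mult_1 norm_of_real by (simp add: abs_mult)
      also have "\<dots> \<le> \<theta>\<^sup>2 / 2 * H"
        by (intro mult_left_mono H) auto
      finally show "norm (?e n \<omega> * of_real (1 - \<theta>\<^sup>2 / 2 * h (X n \<omega>)) - ?e n \<omega>) \<le> \<theta>\<^sup>2 / 2 * H" .
    qed
    finally show ?thesis .
  qed
  have "(LINT \<omega>|M. ?e 0 \<omega>) = 1"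
    by (simp add: path_sum_def prob_space)
  then have z0: "norm (z 0 - 1) \<le> \<theta>\<^sup>2 / 2 * H"
    using zu[of 0] by simp
  have "(LINT \<omega>|M. ?e n \<omega>) - of_real (?q ^ n)
      = (z n - of_real (?q ^ n) * z 0) - (z n - (LINT \<omega>|M. ?e n \<omega>)) + of_real (?q ^ n) * (z 0 - 1)"
    by (simp add: algebra_simps)
  also have "norm \<dots> \<le> norm (z n - of_real (?q ^ n) * z 0) + norm (z n - (LINT \<omega>|M. ?e n \<omega>))
       + norm (of_real (?q ^ n) * (z 0 - 1))"
    by (intro norm_triangle_le add_right_mono norm_triangle_ineq4)
  also have "\<dots> \<le> n * ?K + \<theta>\<^sup>2 / 2 * H + 1 * (\<theta>\<^sup>2 / 2 * H)"
  proof (intro add_mono zn zu)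
    have "\<bar>?q ^ n\<bar> \<le> 1"
      using q1 by (simp add: power_abs power_le_one)
    then show "norm (of_real (?q ^ n) * (z 0 - 1)) \<le> 1 * (\<theta>\<^sup>2 / 2 * H)"
      unfolding norm_mult norm_of_real by (intro mult_mono z0) auto
  qed
  finally show ?thesis
    by (simp add: algebra_simps)
qed

text \<open>For \<open>\<theta> = t / sqrt n\<close> the accumulated error \<open>n \<bar>\<theta>\<bar>\<^sup>3 = \<bar>t\<bar>\<^sup>3 / sqrt n\<close> vanishes.\<close>

lemma char_path_sum_tendsto:
  assumes P: "stochastic_matrix P" "irreducible_matrix P" and \<pi>: "stationary_vec P \<pi>"
    and centred: "\<And>i. (\<Sum>j\<in>UNIV. P $ i $ j * g i j) = 0"
  defines "\<sigma>2 \<equiv> (\<Sum>i\<in>UNIV. \<pi> $ i * (\<Sum>j\<in>UNIV. P $ i $ j * (g i j)\<^sup>2))"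
  shows "(\<lambda>n. LINT \<omega>|M. iexp (t * (path_sum g n (\<lambda>l. X l \<omega>) / sqrt n))) \<longlonglongrightarrow> of_real (exp (- (t\<^sup>2 * \<sigma>2 / 2)))"
proof -
  obtain h where h: "\<And>i. (\<Sum>j\<in>UNIV. P $ i $ j * (g i j)\<^sup>2) = \<sigma>2 + h $ i - (\<Sum>j\<in>UNIV. P $ i $ j * h $ j)"
    by (rule poisson_equation[OF P \<pi>, of "\<lambda>i. \<Sum>j\<in>UNIV. P $ i $ j * (g i j)\<^sup>2", folded \<sigma>2_def, OF that])
  define G where "G = (\<Sum>i\<in>UNIV. \<Sum>j\<in>UNIV. \<bar>g i j\<bar>)"
  define H where "H = (\<Sum>i\<in>UNIV. \<bar>h $ i\<bar>)"
  have H: "\<bar>h $ j\<bar> \<le> H" for j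
    unfolding H_def by (rule member_le_sum) auto
  have G: "\<bar>g i j\<bar> \<le> G" for i j
  proof -
    have "\<bar>g i j\<bar> \<le> (\<Sum>j\<in>UNIV. \<bar>g i j\<bar>)"
      by (rule member_le_sum) auto
    also have "\<dots> \<le> G"
      unfolding G_def by (rule member_le_sum[of i UNIV "\<lambda>i. \<Sum>j\<in>UNIV. \<bar>g i j\<bar>"]) (auto intro: sum_nonneg)
    finally show ?thesis .
  qed
  have \<sigma>2: "0 \<le> \<sigma>2"
    using P(1) \<pi> unfolding \<sigma>2_def
    by (intro sum_nonneg mult_nonneg_nonneg) (auto simp: stochastic_matrix_def stationary_vec_def)
  let ?u = "\<lambda>n::nat. LINT \<omega>|M. iexp (t * (path_sum g n (\<lambda>l. X l \<omega>) / sqrt n))"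
  let ?p = "\<lambda>n::nat. (1 + (- (t\<^sup>2 * \<sigma>2 / 2)) / n) ^ n"
  let ?K = "G ^ 3 + G * H + \<sigma>2 * H"
  let ?b = "\<lambda>n::nat. ?K * \<bar>t\<bar> ^ 3 / sqrt n + t\<^sup>2 * H / n"
  have "\<forall>\<^sub>F n in sequentially. t\<^sup>2 \<le> n \<and> t\<^sup>2 * \<sigma>2 / 2 \<le> n \<and> 1 \<le> n"
    by (intro eventually_conj eventually_ge_at_top
        filterlim_real_sequentially[unfolded filterlim_at_top, rule_format])
  then have "\<forall>\<^sub>F n in sequentially. norm (?u n - of_real (?p n)) \<le> ?b n"
  proof eventually_elim
    case (elim n)
    then have n: "0 < real n" by simp
    define \<theta> where "\<theta> = t / sqrt n"
    have \<theta>2: "\<theta>\<^sup>2 = t\<^sup>2 / n"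
      using n by (simp add: \<theta>_def power_divide)
    have "\<theta>\<^sup>2 \<le> 1"
      using elim n by (simp add: \<theta>2)
    then have \<theta>1: "\<bar>\<theta>\<bar> \<le> 1"
      by (simp add: abs_square_le_1)
    have q: "\<theta>\<^sup>2 / 2 * \<sigma>2 \<le> 1"
      using elim n by (simp add: \<theta>2 field_simps)
    have "real n * \<bar>\<theta>\<bar> ^ 3 = real n * \<theta>\<^sup>2 * \<bar>\<theta>\<bar>"
      by (simp add: eval_nat_numeral)
    also have "\<dots> = \<bar>t\<bar> ^ 3 / sqrt n"
      using n unfolding \<theta>2 by (simp add: \<theta>_def eval_nat_numeral)
    finally have n3: "real n * \<bar>\<theta>\<bar> ^ 3 = \<bar>t\<bar> ^ 3 / sqrt n" .
    have "norm ((LINT \<omega>|M. iexp (\<theta> * path_sum g n (\<lambda>l. X l \<omega>))) - of_real ((1 - \<theta>\<^sup>2 / 2 * \<sigma>2) ^ n))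
           \<le> n * (?K * \<bar>\<theta>\<bar> ^ 3) + \<theta>\<^sup>2 * H"
      by (rule char_path_sum_approx[where h="($) h", OF P(1) centred h G H \<theta>1 \<sigma>2 q])
    also have "real n * (?K * \<bar>\<theta>\<bar> ^ 3) = ?K * (real n * \<bar>\<theta>\<bar> ^ 3)"
      by (simp only: mult_ac)
    also have "?K * (real n * \<bar>\<theta>\<bar> ^ 3) + \<theta>\<^sup>2 * H = ?b n"
      unfolding n3 \<theta>2 by simp
    also have "(1 - \<theta>\<^sup>2 / 2 * \<sigma>2) = 1 + (- (t\<^sup>2 * \<sigma>2 / 2)) / n"
      unfolding \<theta>2 by simp
    also have "(\<lambda>\<omega>. iexp (\<theta> * path_sum g n (\<lambda>l. X l \<omega>))) = (\<lambda>\<omega>. iexp (t * (path_sum g n (\<lambda>l. X l \<omega>) / sqrt n)))"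
      by (simp add: \<theta>_def)
    finally show ?case .
  qed
  moreover have "?b \<longlonglongrightarrow> 0"
  proof -
    have 1: "(\<lambda>n::nat. ?K * \<bar>t\<bar> ^ 3 / sqrt n) \<longlonglongrightarrow> 0"
      by (intro tendsto_divide_0[OF tendsto_const] filterlim_at_top_imp_at_infinity
          filterlim_compose[OF sqrt_at_top] filterlim_real_sequentially)
    have 2: "(\<lambda>n::nat. t\<^sup>2 * H / n) \<longlonglongrightarrow> 0"
      by (intro tendsto_divide_0[OF tendsto_const] filterlim_at_top_imp_at_infinity
          filterlim_real_sequentially)
    from tendsto_add[OF 1 2] show ?thesis by simp
  qed
  ultimately have "(\<lambda>n. ?u n - of_real (?p n)) \<longlonglongrightarrow> 0"
    by (rule Lim_null_comparison)
  moreover have "(\<lambda>n. of_real (?p n) :: complex) \<longlonglongrightarrow> of_real (exp (- (t\<^sup>2 * \<sigma>2 / 2)))"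
    by (intro tendsto_of_real tendsto_exp_limit_sequentially)
  ultimately show ?thesis
    using tendsto_add[of "\<lambda>n. ?u n - of_real (?p n)" 0 sequentially "\<lambda>n. of_real (?p n)"] by simp
qed

end

section \<open>Gaussian laws and the limit matrix\<close>

lemma gaussian_rv_square_integrable:
  assumes N: "prob_space N" and Z: "gaussian_rv N Z"
  shows "integrable N (\<lambda>\<omega>. (Z \<omega>)\<^sup>2)" and "integrable N Z"
proof -
  interpret prob_space N by (rule N)
  have Zm: "Z \<in> borel_measurable N"
    using Z by (simp add: gaussian_rv_def)
  consider (const) \<mu> where "AE \<omega> in N. Z \<omega> = \<mu>"
    | (normal) \<mu> \<sigma> where "0 < \<sigma>" "distributed N lborel Z (\<lambda>x. ennreal (normal_density \<mu> \<sigma> x))"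
    using Z unfolding gaussian_rv_def by blast
  then show sq: "integrable N (\<lambda>\<omega>. (Z \<omega>)\<^sup>2)"
  proof cases
    case const
    have "integrable N (\<lambda>\<omega>. (Z \<omega>)\<^sup>2) \<longleftrightarrow> integrable N (\<lambda>\<omega>. \<mu>\<^sup>2)"
      by (rule integrable_cong_AE) (use const Zm in auto)
    then show ?thesis by simp
  next
    case normal
    have "integrable lborel (\<lambda>x. normal_density \<mu> \<sigma> x * (x - \<mu>)\<^sup>2 + 2 * \<mu> * (normal_density \<mu> \<sigma> x * x)
              - \<mu>\<^sup>2 * normal_density \<mu> \<sigma> x)"
      using normal(1) integrable_normal_moment[of \<sigma> \<mu> 2] integrable_normal_moment_nz_1[of \<sigma> \<mu>]
      by (intro Bochner_Integration.integrable_diff Bochner_Integration.integrable_add integrable_mult_right) auto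
    also have "(\<lambda>x. normal_density \<mu> \<sigma> x * (x - \<mu>)\<^sup>2 + 2 * \<mu> * (normal_density \<mu> \<sigma> x * x)
              - \<mu>\<^sup>2 * normal_density \<mu> \<sigma> x) = (\<lambda>x. normal_density \<mu> \<sigma> x * x\<^sup>2)"
      by (rule ext) (simp add: power2_eq_square algebra_simps)
    finally show ?thesis
      using distributed_integrable[OF normal(2), of "\<lambda>x. x\<^sup>2"] by simp
  qed
  show "integrable N Z"
    by (rule square_integrable_imp_integrable[OF Zm sq])
qed

text \<open>The degenerate law is the case of variance zero of the same formula: an almost surely constant
  variable with mean zero vanishes.\<close>

lemma char_centred_gaussian_rv:
  assumes N: "prob_space N" and Z: "gaussian_rv N Z" and mean: "(LINT \<omega>|N. Z \<omega>) = 0"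
  shows "(LINT \<omega>|N. iexp (t * Z \<omega>)) = of_real (exp (- (t\<^sup>2 * (LINT \<omega>|N. (Z \<omega>)\<^sup>2) / 2)))"
proof -
  interpret prob_space N by (rule N)
  have Zm [measurable]: "Z \<in> borel_measurable N"
    using Z by (simp add: gaussian_rv_def)
  consider (const) \<mu> where "AE \<omega> in N. Z \<omega> = \<mu>"
    | (normal) \<mu> \<sigma> where "0 < \<sigma>" "distributed N lborel Z (\<lambda>x. ennreal (normal_density \<mu> \<sigma> x))"
    using Z unfolding gaussian_rv_def by blast
  then show ?thesis
  proof cases
    case const
    have "(LINT \<omega>|N. Z \<omega>) = (LINT \<omega>|N. \<mu>)"
      by (rule integral_cong_AE) (use const in auto)
    then have AE0: "AE \<omega> in N. Z \<omega> = 0"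
      using const mean by (simp add: prob_space)
    have "(LINT \<omega>|N. (Z \<omega>)\<^sup>2) = (LINT \<omega>|N. 0)"
      by (rule integral_cong_AE) (use AE0 in auto)
    moreover have "(LINT \<omega>|N. iexp (t * Z \<omega>)) = (LINT \<omega>|N. 1)"
      by (rule integral_cong_AE) (use AE0 in auto)
    ultimately show ?thesis
      by (simp add: prob_space)
  next
    case normal
    have \<mu>: "\<mu> = 0"
      using normal_distributed_expectation[OF normal] mean by simp
    have var: "(LINT \<omega>|N. (Z \<omega>)\<^sup>2) = \<sigma>\<^sup>2"
      using normal_distributed_variance[OF normal] mean by simp
    have std: "distributed N lborel (\<lambda>\<omega>. Z \<omega> / \<sigma>) std_normal_density"
      using normal_standard_normal_convert[OF normal(1), of Z \<mu>] normal(2) \<mu> by simp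
    have "(LINT \<omega>|N. iexp (t * Z \<omega>)) = (LINT \<omega>|N. iexp (t * \<sigma> * (Z \<omega> / \<sigma>)))"
      using normal(1) by simp
    also have "\<dots> = (LINT x|distr N lborel (\<lambda>\<omega>. Z \<omega> / \<sigma>). iexp (t * \<sigma> * x))"
      by (subst integral_distr) auto
    also have "distr N lborel (\<lambda>\<omega>. Z \<omega> / \<sigma>) = std_normal_distribution"
      by (rule distributed_distr_eq_density[OF std])
    also have "(LINT x|std_normal_distribution. iexp (t * \<sigma> * x)) = char std_normal_distribution (t * \<sigma>)"
      by (simp add: char_def)
    also have "\<dots> = of_real (exp (- (t\<^sup>2 * (LINT \<omega>|N. (Z \<omega>)\<^sup>2) / 2)))"
      by (simp add: char_std_normal_distribution var power_mult_distrib)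
    finally show ?thesis .
  qed
qed

lemma inner_matrix_eq_sum:
  fixes A B :: "real ^ 's::finite ^ 's"
  shows "A \<bullet> B = (\<Sum>i\<in>UNIV. \<Sum>j\<in>UNIV. A $ i $ j * B $ i $ j)"
  by (simp add: inner_vec_def)

text \<open>The second moment is written as a stationary average of conditional variances, because this is the
  form in which the variance appears in \<open>char_path_sum_tendsto\<close>.\<close>

lemma limit_matrix_moments:
  fixes P C :: "real ^ 's::finite ^ 's"
  assumes W: "limit_matrix P \<pi> N W" and \<pi>: "\<And>i. 0 < \<pi> $ i" and P: "stochastic_matrix P"
  shows "(LINT \<omega>|N. C \<bullet> W \<omega>) = 0"
    and "(LINT \<omega>|N. (C \<bullet> W \<omega>)\<^sup>2) = (\<Sum>i\<in>UNIV. \<pi> $ i *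
           (\<Sum>j\<in>UNIV. P $ i $ j * ((C $ i $ j - (\<Sum>l\<in>UNIV. P $ i $ l * C $ i $ l)) / \<pi> $ i)\<^sup>2))"
proof -
  interpret prob_space N
    using W by (simp add: limit_matrix_def)
  have gW: "gaussian_vec N W"
    using W by (simp add: limit_matrix_def)
  have rv: "gaussian_rv N (\<lambda>\<omega>. W \<omega> $ i $ j)" for i j
  proof -
    have "gaussian_rv N (\<lambda>\<omega>. axis i (axis j 1) \<bullet> W \<omega>)"
      using gW by (simp add: gaussian_vec_def)
    also have "(\<lambda>\<omega>. axis i (axis j 1) \<bullet> W \<omega>) = (\<lambda>\<omega>. W \<omega> $ i $ j)"
      by (simp add: inner_axis')
    finally show ?thesis .
  qed
  note int = gaussian_rv_square_integrable[OF prob_space_axioms rv]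
  have int2: "integrable N (\<lambda>\<omega>. W \<omega> $ i $ j * W \<omega> $ k $ l)" for i j k l
  proof (rule Bochner_Integration.integrable_bound)
    show "integrable N (\<lambda>\<omega>. (W \<omega> $ i $ j)\<^sup>2 + (W \<omega> $ k $ l)\<^sup>2)"
      using int by auto
    show "(\<lambda>\<omega>. W \<omega> $ i $ j * W \<omega> $ k $ l) \<in> borel_measurable N"
      using rv unfolding gaussian_rv_def by (intro borel_measurable_times) auto
    have "norm (x * y) \<le> norm (x\<^sup>2 + y\<^sup>2)" for x y :: real
    proof -
      have "2 * \<bar>x\<bar> * \<bar>y\<bar> \<le> \<bar>x\<bar>\<^sup>2 + \<bar>y\<bar>\<^sup>2"
        by (rule sum_squares_bound)
      moreover have "0 \<le> \<bar>x\<bar> * \<bar>y\<bar>"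
        by simp
      ultimately have "\<bar>x\<bar> * \<bar>y\<bar> \<le> x\<^sup>2 + y\<^sup>2"
        unfolding power2_abs by linarith
      then show ?thesis
        by (simp add: abs_mult)
    qed
    then show "AE \<omega> in N. norm (W \<omega> $ i $ j * W \<omega> $ k $ l) \<le> norm ((W \<omega> $ i $ j)\<^sup>2 + (W \<omega> $ k $ l)\<^sup>2)"
      by auto
  qed
  have m0: "(LINT \<omega>|N. W \<omega> $ i $ j) = 0" for i j
    using W by (simp add: limit_matrix_def)
  have cov: "(LINT \<omega>|N. W \<omega> $ i $ j * W \<omega> $ k $ l) =
        (if i = k then 1 / \<pi> $ i * P $ i $ j * ((if j = l then 1 else 0) - P $ i $ l) else 0)" for i j k l
    using W m0 by (simp add: limit_matrix_def covariance_def)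
  show "(LINT \<omega>|N. C \<bullet> W \<omega>) = 0"
    unfolding inner_matrix_eq_sum using int m0 by (simp add: Bochner_Integration.integral_sum)
  have "(LINT \<omega>|N. (C \<bullet> W \<omega>)\<^sup>2)
      = (LINT \<omega>|N. (\<Sum>i\<in>UNIV. \<Sum>k\<in>UNIV. \<Sum>j\<in>UNIV. \<Sum>l\<in>UNIV. (C $ i $ j * C $ k $ l) * (W \<omega> $ i $ j * W \<omega> $ k $ l)))"
    unfolding inner_matrix_eq_sum power2_eq_square sum_product
    by (simp only: mult_ac)
  also have "\<dots> = (\<Sum>i\<in>UNIV. \<Sum>k\<in>UNIV. \<Sum>j\<in>UNIV. \<Sum>l\<in>UNIV. (C $ i $ j * C $ k $ l) * (LINT \<omega>|N. W \<omega> $ i $ j * W \<omega> $ k $ l))"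
    using int2 by (simp add: Bochner_Integration.integral_sum)
  also have "\<dots> = (\<Sum>i\<in>UNIV. \<Sum>k\<in>UNIV. if i = k then (\<Sum>j\<in>UNIV. \<Sum>l\<in>UNIV. (C $ i $ j * C $ i $ l) *
          (1 / \<pi> $ i * P $ i $ j * ((if j = l then 1 else 0) - P $ i $ l))) else 0)"
    unfolding cov by (intro sum.cong refl) auto
  also have "\<dots> = (\<Sum>i\<in>UNIV. \<Sum>j\<in>UNIV. \<Sum>l\<in>UNIV. (C $ i $ j * C $ i $ l) *
          (1 / \<pi> $ i * P $ i $ j * ((if j = l then 1 else 0) - P $ i $ l)))"
    by simp
  also have "\<dots> = (\<Sum>i\<in>UNIV. \<pi> $ i *
           (\<Sum>j\<in>UNIV. P $ i $ j * ((C $ i $ j - (\<Sum>l\<in>UNIV. P $ i $ l * C $ i $ l)) / \<pi> $ i)\<^sup>2))"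
  proof (rule sum.cong[OF refl])
    fix i
    define p where "p = (\<lambda>j. P $ i $ j)"
    define c where "c = (\<lambda>j. C $ i $ j)"
    define m where "m = (\<Sum>l\<in>UNIV. p l * c l)"
    have p1: "sum p UNIV = 1"
      using P by (simp add: p_def stochastic_matrix_def)
    have "(\<Sum>l\<in>UNIV. (c j * c l) * (1 / \<pi> $ i * p j * ((if j = l then 1 else 0) - p l)))
        = (p j * (c j)\<^sup>2 - p j * c j * m) / \<pi> $ i" for j
    proof -
      have "(c j * c l) * (1 / \<pi> $ i * p j * ((if j = l then 1 else 0) - p l))
          = (if j = l then p j * (c j)\<^sup>2 / \<pi> $ i else 0) - p j * c j / \<pi> $ i * (p l * c l)" for l
        using \<pi>[of i] by (cases "j = l") (simp_all add: divide_simps power2_eq_square algebra_simps)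
      then have "(\<Sum>l\<in>UNIV. (c j * c l) * (1 / \<pi> $ i * p j * ((if j = l then 1 else 0) - p l)))
          = (\<Sum>l\<in>UNIV. if j = l then p j * (c j)\<^sup>2 / \<pi> $ i else 0) - p j * c j / \<pi> $ i * m"
        by (simp only: sum_subtractf sum_distrib_left[symmetric] m_def)
      then show ?thesis
        by (simp add: diff_divide_distrib)
    qed
    then have "(\<Sum>j\<in>UNIV. \<Sum>l\<in>UNIV. (c j * c l) * (1 / \<pi> $ i * p j * ((if j = l then 1 else 0) - p l)))
        = (\<Sum>j\<in>UNIV. (p j * (c j)\<^sup>2 - p j * c j * m) / \<pi> $ i)"
      by simp
    also have "\<dots> = ((\<Sum>j\<in>UNIV. p j * (c j)\<^sup>2) - m * m) / \<pi> $ i"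
      by (simp add: sum_divide_distrib[symmetric] sum_subtractf sum_distrib_right[symmetric] m_def[symmetric])
    also have "(\<Sum>j\<in>UNIV. p j * (c j)\<^sup>2) - m * m = (\<Sum>j\<in>UNIV. p j * (c j - m)\<^sup>2)"
    proof -
      have "(\<Sum>j\<in>UNIV. p j * (c j - m)\<^sup>2) = (\<Sum>j\<in>UNIV. p j * (c j)\<^sup>2 - 2 * m * (p j * c j) + m * m * p j)"
        by (intro sum.cong refl) (simp add: power2_eq_square algebra_simps)
      also have "\<dots> = (\<Sum>j\<in>UNIV. p j * (c j)\<^sup>2) - 2 * m * m + m * m * 1"
        unfolding sum.distrib sum_subtractf sum_distrib_left[symmetric] m_def[symmetric] p1 ..
      finally show ?thesis by simp
    qed
    also have "\<dots> / \<pi> $ i = \<pi> $ i * (\<Sum>j\<in>UNIV. p j * ((c j - m) / \<pi> $ i)\<^sup>2)"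
      using \<pi>[of i] by (simp add: power_divide sum_divide_distrib[symmetric] power2_eq_square)
    finally show "(\<Sum>j\<in>UNIV. \<Sum>l\<in>UNIV. (C $ i $ j * C $ i $ l) *
          (1 / \<pi> $ i * P $ i $ j * ((if j = l then 1 else 0) - P $ i $ l)))
       = \<pi> $ i * (\<Sum>j\<in>UNIV. P $ i $ j * ((C $ i $ j - (\<Sum>l\<in>UNIV. P $ i $ l * C $ i $ l)) / \<pi> $ i)\<^sup>2)"
      unfolding p_def c_def m_def .
  qed
  finally show "(LINT \<omega>|N. (C \<bullet> W \<omega>)\<^sup>2) = (\<Sum>i\<in>UNIV. \<pi> $ i *
           (\<Sum>j\<in>UNIV. P $ i $ j * ((C $ i $ j - (\<Sum>l\<in>UNIV. P $ i $ l * C $ i $ l)) / \<pi> $ i)\<^sup>2))" .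
qed

section \<open>The delta method for the empirical transition matrix\<close>

lemma norm_iexp_diff_le: "norm (iexp x - iexp y) \<le> \<bar>x - y\<bar>"
proof -
  have "iexp x - iexp y = iexp y * (iexp (x - y) - 1)"
    by (simp add: algebra_simps exp_diff)
  also have "norm \<dots> = norm (iexp (x - y) - 1)"
    unfolding norm_mult norm_exp_i_times by simp
  also have "\<dots> \<le> \<bar>x - y\<bar>"
    using iexp_approx1[of "x - y" 0] by simp
  finally show ?thesis .
qed

text \<open>Where \<open>A n\<close> and \<open>B n\<close> differ by at most \<open>\<epsilon>\<close>, the integrands differ by at most \<open>\<bar>t\<bar> \<epsilon>\<close>; elsewhere
  they differ by at most 2.\<close>

lemma (in prob_space) char_tendsto_slutsky:
  assumes A [measurable]: "\<And>n. A n \<in> borel_measurable M" and B [measurable]: "\<And>n. B n \<in> borel_measurable M"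
    and AB: "\<And>\<epsilon>. 0 < \<epsilon> \<Longrightarrow> (\<lambda>n. \<P>(\<omega> in M. \<epsilon> < \<bar>A n \<omega> - B n \<omega>\<bar>)) \<longlonglongrightarrow> 0"
    and lim: "(\<lambda>n. LINT \<omega>|M. iexp (t * B n \<omega>)) \<longlonglongrightarrow> z"
  shows "(\<lambda>n. LINT \<omega>|M. iexp (t * A n \<omega>)) \<longlonglongrightarrow> z"
proof -
  have int: "integrable M (\<lambda>\<omega>. iexp (t * F \<omega>))" if "F \<in> borel_measurable M" for F
    using that by (intro integrable_iexp) auto
  have bound: "norm ((LINT \<omega>|M. iexp (t * A n \<omega>)) - (LINT \<omega>|M. iexp (t * B n \<omega>)))
      \<le> \<bar>t\<bar> * \<epsilon> + 2 * \<P>(\<omega> in M. \<epsilon> < \<bar>A n \<omega> - B n \<omega>\<bar>)" if "0 < \<epsilon>" for n \<epsilon>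
  proof -
    let ?E = "{\<omega> \<in> space M. \<epsilon> < \<bar>A n \<omega> - B n \<omega>\<bar>}"
    have E: "?E \<in> sets M" by measurable
    have "(LINT \<omega>|M. iexp (t * A n \<omega>)) - (LINT \<omega>|M. iexp (t * B n \<omega>))
       = (LINT \<omega>|M. iexp (t * A n \<omega>) - iexp (t * B n \<omega>))"
      by (rule Bochner_Integration.integral_diff[symmetric, OF int[OF A] int[OF B]])
    also have "norm \<dots> \<le> (LINT \<omega>|M. norm (iexp (t * A n \<omega>) - iexp (t * B n \<omega>)))"
      by (rule integral_norm_bound)
    also have "\<dots> \<le> (LINT \<omega>|M. \<bar>t\<bar> * \<epsilon> + 2 * indicator ?E \<omega>)"
    proof (rule integral_mono)
      show "integrable M (\<lambda>\<omega>. norm (iexp (t * A n \<omega>) - iexp (t * B n \<omega>)))"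
        by (intro integrable_norm Bochner_Integration.integrable_diff int A B)
      show "integrable M (\<lambda>\<omega>. \<bar>t\<bar> * \<epsilon> + 2 * indicator ?E \<omega>)"
        using E by (simp add: emeasure_eq_measure)
      fix \<omega> assume w: "\<omega> \<in> space M"
      show "norm (iexp (t * A n \<omega>) - iexp (t * B n \<omega>)) \<le> \<bar>t\<bar> * \<epsilon> + 2 * indicator ?E \<omega>"
      proof (cases "\<omega> \<in> ?E")
        case True
        have "norm (iexp (t * A n \<omega>) - iexp (t * B n \<omega>)) \<le> norm (iexp (t * A n \<omega>)) + norm (iexp (t * B n \<omega>))"
          by (rule norm_triangle_ineq4)
        then have "norm (iexp (t * A n \<omega>) - iexp (t * B n \<omega>)) \<le> 2"
          unfolding norm_exp_i_times by simp
        moreover have "0 \<le> \<bar>t\<bar> * \<epsilon>"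
          using that by simp
        ultimately show ?thesis
          using True by simp
      next
        case False
        have "norm (iexp (t * A n \<omega>) - iexp (t * B n \<omega>)) \<le> \<bar>t * A n \<omega> - t * B n \<omega>\<bar>"
          by (rule norm_iexp_diff_le)
        also have "\<dots> = \<bar>t\<bar> * \<bar>A n \<omega> - B n \<omega>\<bar>"
          by (simp add: abs_mult right_diff_distrib[symmetric])
        also have "\<dots> \<le> \<bar>t\<bar> * \<epsilon>"
          using False w by (intro mult_left_mono) auto
        finally show ?thesis
          using False by simp
      qed
    qed
    also have "\<dots> = \<bar>t\<bar> * \<epsilon> + 2 * measure M ?E"
      using E by (simp add: emeasure_eq_measure prob_space)
    finally show ?thesis .
  qed
  have "(\<lambda>n. (LINT \<omega>|M. iexp (t * A n \<omega>)) - (LINT \<omega>|M. iexp (t * B n \<omega>))) \<longlonglongrightarrow> 0"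
  proof (rule LIMSEQ_I)
    fix r :: real assume r: "0 < r"
    define \<epsilon> where "\<epsilon> = r / (2 * (\<bar>t\<bar> + 1))"
    have \<epsilon>: "0 < \<epsilon>"
      using r by (simp add: \<epsilon>_def add_nonneg_pos)
    have t\<epsilon>: "\<bar>t\<bar> * \<epsilon> \<le> r / 2"
      using r by (simp add: \<epsilon>_def field_simps)
    obtain n0 where n0: "\<And>n. n0 \<le> n \<Longrightarrow> norm (\<P>(\<omega> in M. \<epsilon> < \<bar>A n \<omega> - B n \<omega>\<bar>) - 0) < r / 4"
      using LIMSEQ_D[OF AB[OF \<epsilon>], of "r / 4"] r by auto
    have "norm ((LINT \<omega>|M. iexp (t * A n \<omega>)) - (LINT \<omega>|M. iexp (t * B n \<omega>)) - 0) < r" if "n0 \<le> n" for n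
      using bound[OF \<epsilon>, of n] n0[OF that] t\<epsilon> by simp
    then show "\<exists>n0. \<forall>n\<ge>n0. norm ((LINT \<omega>|M. iexp (t * A n \<omega>)) - (LINT \<omega>|M. iexp (t * B n \<omega>)) - 0) < r"
      by blast
  qed
  from tendsto_add[OF this lim] show ?thesis by simp
qed

text \<open>As a function of the transition \<open>(k, l)\<close> this is the martingale increment behind the error of the
  estimator of \<open>P $ i $ j\<close>; only steps out of \<open>i\<close> contribute.\<close>

definition trans_residual :: "real ^ 's::finite ^ 's \<Rightarrow> 's \<Rightarrow> 's \<Rightarrow> 's \<Rightarrow> 's \<Rightarrow> real" where
  "trans_residual P i j k l = of_bool (k = i) * (of_bool (l = j) - P $ i $ j)"

lemma trans_residual_centred:
  assumes "stochastic_matrix P"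
  shows "(\<Sum>l\<in>UNIV. P $ k $ l * trans_residual P i j k l) = 0"
proof -
  have "(\<Sum>l\<in>UNIV. P $ k $ l * trans_residual P i j k l)
      = of_bool (k = i) * ((\<Sum>l\<in>UNIV. P $ i $ l * of_bool (l = j)) - (\<Sum>l\<in>UNIV. P $ i $ l) * P $ i $ j)"
    by (cases "k = i") (simp_all add: trans_residual_def right_diff_distrib sum_subtractf sum_distrib_right)
  also have "\<dots> = 0"
    using assms by (simp add: stochastic_matrix_def of_bool_def mult_delta_right)
  finally show ?thesis .
qed

lemma trans_residual_bound:
  assumes "stochastic_matrix P"
  shows "\<bar>trans_residual P i j k l\<bar> \<le> 1"
proof -
  have "0 \<le> P $ i $ j"
    using assms by (simp add: stochastic_matrix_def)
  moreover have "P $ i $ j \<le> (\<Sum>j\<in>UNIV. P $ i $ j)"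
    using assms by (intro member_le_sum) (auto simp: stochastic_matrix_def)
  ultimately show ?thesis
    using assms by (auto simp: trans_residual_def stochastic_matrix_def of_bool_def)
qed

lemma trans_count_eq_sum:
  "real (trans_count X n i j \<omega>) = (\<Sum>m<n. of_bool (X m \<omega> = i) * of_bool (X (Suc m) \<omega> = j))"
proof -
  have "{m. m < n \<and> X m \<omega> = i \<and> X (Suc m) \<omega> = j} = {..<n} \<inter> {m. X m \<omega> = i \<and> X (Suc m) \<omega> = j}"
    by auto
  then show ?thesis
    by (simp add: trans_count_def of_bool_conj[symmetric])
qed

lemma exit_count_eq_sum:
  fixes X :: "nat \<Rightarrow> 'a \<Rightarrow> 's::finite"
  shows "real (exit_count X n i \<omega>) = (\<Sum>m<n. of_bool (X m \<omega> = i))"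
proof -
  have "real (exit_count X n i \<omega>) = (\<Sum>m<n. \<Sum>j\<in>UNIV. of_bool (X m \<omega> = i) * of_bool (X (Suc m) \<omega> = j))"
    unfolding exit_count_def of_nat_sum trans_count_eq_sum by (rule sum.swap)
  also have "\<dots> = (\<Sum>m<n. of_bool (X m \<omega> = i))"
    by (simp add: sum_distrib_left[symmetric] of_bool_def)
  finally show ?thesis .
qed

lemma emp_trans_minus:
  assumes "exit_count X n i \<omega> \<noteq> 0"
  shows "(emp_trans X n \<omega> - P) $ i $ j
       = path_sum (trans_residual P i j) n (\<lambda>l. X l \<omega>) / real (exit_count X n i \<omega>)"
proof -
  have "path_sum (trans_residual P i j) n (\<lambda>l. X l \<omega>)
      = real (trans_count X n i j \<omega>) - P $ i $ j * real (exit_count X n i \<omega>)"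
    unfolding path_sum_def trans_residual_def exit_count_eq_sum trans_count_eq_sum
    by (simp add: right_diff_distrib sum_subtractf sum_distrib_left mult_ac)
  with assms show ?thesis
    by (simp add: emp_trans_def diff_divide_distrib)
qed

lemma norm_matrix_le:
  fixes A :: "real ^ 's::finite ^ 's"
  assumes "\<And>i j. \<bar>A $ i $ j\<bar> \<le> c"
  shows "norm A \<le> (real CARD('s))\<^sup>2 * c"
proof -
  have "norm A \<le> (\<Sum>i\<in>UNIV. norm (A $ i))"
    unfolding norm_vec_def by (rule L2_set_le_sum) simp
  also have "\<dots> \<le> (\<Sum>i\<in>(UNIV :: 's set). \<Sum>j\<in>(UNIV :: 's set). c)"
    by (intro sum_mono order_trans[OF norm_le_l1_cart] assms)
  finally show ?thesis
    by (simp add: power2_eq_square)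
qed

context finite_markov_chain
begin

text \<open>Solving the Poisson equation for the indicator of \<open>i\<close> turns the deviation of the occupation count
  from \<open>n \<pi>\<^sub>i\<close> into a centred sum over transitions plus the bounded boundary term
  \<open>h(X\<^sub>0) - h(X\<^sub>n)\<close>.  The sum has standard deviation of order \<open>sqrt n\<close>, so Chebyshev's inequality
  applies.\<close>

lemma occupation_lln:
  assumes P: "stochastic_matrix P" "irreducible_matrix P" and \<pi>: "stationary_vec P \<pi>" and \<eta>: "0 < \<eta>"
  shows "(\<lambda>n. \<P>(\<omega> in M. \<eta> \<le> \<bar>exit_count X n i \<omega> / n - \<pi> $ i\<bar>)) \<longlonglongrightarrow> 0"
proof -
  define f :: "'s \<Rightarrow> real" where "f k = of_bool (k = i)" for k
  have f\<pi>: "(\<Sum>k\<in>UNIV. \<pi> $ k * f k) = \<pi> $ i"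
    by (simp add: f_def of_bool_def mult_delta_right)
  obtain h where h: "\<And>k. f k = \<pi> $ i + h $ k - (\<Sum>j\<in>UNIV. P $ k $ j * h $ j)"
    by (rule poisson_equation[OF P \<pi>, of f, unfolded f\<pi>, OF that])
  define H where "H = (\<Sum>i\<in>UNIV. \<bar>h $ i\<bar>)"
  have H: "\<bar>h $ j\<bar> \<le> H" for j
    unfolding H_def by (rule member_le_sum) auto
  define Ph where "Ph k = (\<Sum>j\<in>UNIV. P $ k $ j * h $ j)" for k
  define g where "g k l = h $ l - Ph k" for k l
  have P0: "0 \<le> P $ k $ l" and P1: "(\<Sum>l\<in>UNIV. P $ k $ l) = 1" for k l
    using P by (auto simp: stochastic_matrix_def)
  have centred: "(\<Sum>l\<in>UNIV. P $ k $ l * g k l) = 0" for k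
    by (simp add: g_def right_diff_distrib sum_subtractf sum_distrib_right[symmetric] P1 Ph_def[symmetric])
  have PhH: "\<bar>Ph k\<bar> \<le> H" for k
  proof -
    have "\<bar>Ph k\<bar> \<le> (\<Sum>j\<in>UNIV. P $ k $ j * H)"
      unfolding Ph_def
      by (rule order_trans[OF sum_abs sum_mono]) (simp add: abs_mult P0 H mult_left_mono)
    then show ?thesis
      by (simp add: sum_distrib_right[symmetric] P1)
  qed
  have g: "\<bar>g k l\<bar> \<le> 2 * H" for k l
    using H[of l] PhH[of k] unfolding g_def by linarith
  have decomp: "real (exit_count X n i \<omega>) - n * \<pi> $ i
      = path_sum g n (\<lambda>l. X l \<omega>) + (h $ X 0 \<omega> - h $ X n \<omega>)" for n \<omega>
  proof -
    have "real (exit_count X n i \<omega>) - n * \<pi> $ i = (\<Sum>m<n. f (X m \<omega>) - \<pi> $ i)"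
      by (simp add: exit_count_eq_sum f_def sum_subtractf)
    also have "\<dots> = (\<Sum>m<n. g (X m \<omega>) (X (Suc m) \<omega>) + (h $ X m \<omega> - h $ X (Suc m) \<omega>))"
      by (intro sum.cong refl) (simp add: h g_def Ph_def)
    also have "\<dots> = path_sum g n (\<lambda>l. X l \<omega>) + (h $ X 0 \<omega> - h $ X n \<omega>)"
      unfolding sum.distrib path_sum_def sum_lessThan_telescope'[of "\<lambda>m. h $ X m \<omega>" n] ..
    finally show ?thesis .
  qed
  (* Once n \<eta> is at least 4 H, the boundary term is at most half of a deviation n \<eta>. *)
  let ?b = "\<lambda>n::nat. 16 * H\<^sup>2 / \<eta>\<^sup>2 / n"
  have "\<forall>\<^sub>F n in sequentially. 4 * H / \<eta> \<le> n \<and> 1 \<le> n"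
    by (intro eventually_conj eventually_ge_at_top
        filterlim_real_sequentially[unfolded filterlim_at_top, rule_format])
  then have "\<forall>\<^sub>F n in sequentially. norm (\<P>(\<omega> in M. \<eta> \<le> \<bar>exit_count X n i \<omega> / n - \<pi> $ i\<bar>)) \<le> ?b n"
  proof eventually_elim
    case (elim n)
    then have n: "0 < real n" and n4: "4 * H \<le> n * \<eta>"
      using \<eta> by (simp_all add: field_simps)
    have "\<P>(\<omega> in M. \<eta> \<le> \<bar>exit_count X n i \<omega> / n - \<pi> $ i\<bar>)
        \<le> \<P>(\<omega> in M. n * \<eta> / 2 \<le> \<bar>path_sum g n (\<lambda>l. X l \<omega>)\<bar>)"
    proof (rule finite_measure_mono)
      show "{\<omega> \<in> space M. \<eta> \<le> \<bar>exit_count X n i \<omega> / n - \<pi> $ i\<bar>}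
          \<subseteq> {\<omega> \<in> space M. n * \<eta> / 2 \<le> \<bar>path_sum g n (\<lambda>l. X l \<omega>)\<bar>}"
      proof safe
        fix \<omega> assume "\<eta> \<le> \<bar>exit_count X n i \<omega> / n - \<pi> $ i\<bar>"
        then have "n * \<eta> \<le> n * \<bar>exit_count X n i \<omega> / n - \<pi> $ i\<bar>"
          by (intro mult_left_mono) auto
        also have "\<dots> = \<bar>real (exit_count X n i \<omega>) - n * \<pi> $ i\<bar>"
          using n by (simp add: abs_mult_pos' right_diff_distrib)
        finally show "n * \<eta> / 2 \<le> \<bar>path_sum g n (\<lambda>l. X l \<omega>)\<bar>"
          using decomp[of n \<omega>] H[of "X 0 \<omega>"] H[of "X n \<omega>"] n4 by linarith
      qed
      have [measurable]: "(\<lambda>\<omega>. path_sum g n (\<lambda>l. X l \<omega>)) \<in> borel_measurable M"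
        by (rule measurable_path_functional[where m=n]) (rule path_sum_cong)
      show "{\<omega> \<in> space M. n * \<eta> / 2 \<le> \<bar>path_sum g n (\<lambda>l. X l \<omega>)\<bar>} \<in> sets M"
        by measurable
    qed
    also have "\<dots> \<le> n * (2 * H)\<^sup>2 / (n * \<eta> / 2)\<^sup>2"
      by (rule prob_path_sum_ge[OF centred g]) (use n \<eta> in simp)
    also have "\<dots> = ?b n"
      using n \<eta> by (simp add: power2_eq_square field_simps)
    finally show ?case
      by simp
  qed
  moreover have "?b \<longlonglongrightarrow> 0"
    by (intro tendsto_divide_0[OF tendsto_const] filterlim_at_top_imp_at_infinity
          filterlim_real_sequentially)
  ultimately show ?thesis
    by (rule Lim_null_comparison)
qed

text \<open>The deterministic half of the delta method.  On the event that the occupation frequencies are within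
  \<open>\<eta>\<close> of \<open>\<pi>\<close> and the residual sums are below \<open>K sqrt n\<close>, the matrix error is of order \<open>1 / sqrt n\<close>.
  Then there are two errors to control: the remainder of the differentiable functional, and the
  replacement of the random denominators by \<open>\<pi>\<close>.\<close>

lemma linearisation_error:
  fixes C :: "real ^ 's ^ 's" and Y :: "nat \<Rightarrow> 'a \<Rightarrow> real"
  assumes \<pi>: "\<And>i. 0 < \<pi> $ i"
    and diff: "\<And>e. 0 < e \<Longrightarrow> \<exists>\<delta>>0. \<forall>n. \<forall>\<omega>\<in>space M. norm (emp_trans X n \<omega> - P) < \<delta> \<longrightarrow>
        \<bar>Y n \<omega> - y - C \<bullet> (emp_trans X n \<omega> - P)\<bar> \<le> e * norm (emp_trans X n \<omega> - P)"
    and \<epsilon>: "0 < \<epsilon>" and K: "0 < K"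
  obtains \<eta> n0 where "0 < \<eta>" and "\<And>n \<omega>. \<lbrakk>n0 \<le> n; \<omega> \<in> space M; \<And>i. \<bar>exit_count X n i \<omega> / n - \<pi> $ i\<bar> < \<eta>;
        \<And>i j. \<bar>path_sum (trans_residual P i j) n (\<lambda>l. X l \<omega>)\<bar> < K * sqrt n\<rbrakk>
      \<Longrightarrow> \<bar>sqrt n * (Y n \<omega> - y)
          - path_sum (\<lambda>k l. (C $ k $ l - (\<Sum>l\<in>UNIV. P $ k $ l * C $ k $ l)) / \<pi> $ k) n (\<lambda>l. X l \<omega>) / sqrt n\<bar> \<le> \<epsilon>"
proof -
  obtain p where p: "0 < p" "\<And>i. p \<le> \<pi> $ i"
  proof
    show "0 < Min (range (($) \<pi>))"
      using \<pi> by (subst Min_gr_iff) auto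
    show "Min (range (($) \<pi>)) \<le> \<pi> $ i" for i
      by (rule Min_le) auto
  qed
  define c where "c = (real CARD('s))\<^sup>2 * (2 * K / p)"
  define B where "B = (\<Sum>i\<in>UNIV. \<Sum>j\<in>UNIV. \<bar>C $ i $ j\<bar>)"
  (* The bound p / 2 keeps every frequency above p / 2; the other bound makes the effect of the
     random denominators at most \<epsilon> / 2. *)
  define \<eta> where "\<eta> = min (p / 2) (\<epsilon> * p\<^sup>2 / (4 * K * (B + 1)))"
  (* On the good event the norm of the matrix error is at most c / sqrt n, so a remainder of
     relative size e contributes at most \<epsilon> / 2 after scaling by sqrt n. *)
  define e where "e = \<epsilon> / (2 * c)"
  have c: "0 < c"
    using K p by (simp add: c_def)
  have B: "0 \<le> B"
    unfolding B_def by (intro sum_nonneg) auto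
  have e: "0 < e"
    using \<epsilon> c by (simp add: e_def)
  have \<eta>: "0 < \<eta>"
    using p K B \<epsilon> by (simp add: \<eta>_def)
  have \<eta>p: "\<eta> \<le> p / 2"
    by (simp add: \<eta>_def)
  have \<eta>B: "B * (2 * K * \<eta> / p\<^sup>2) \<le> \<epsilon> / 2"
  proof -
    have "B * (2 * K * \<eta> / p\<^sup>2) \<le> (B + 1) * (2 * K * (\<epsilon> * p\<^sup>2 / (4 * K * (B + 1))) / p\<^sup>2)"
      using B K p \<eta> by (intro mult_mono divide_right_mono mult_left_mono) (auto simp: \<eta>_def)
    also have "\<dots> = \<epsilon> / 2"
    proof -
      have "b * (2 * K * (\<epsilon> * p\<^sup>2 / (4 * K * b)) / p\<^sup>2) = \<epsilon> / 2" if "0 < b" for b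
        using that K p(1) by simp
      then show ?thesis
        using B by simp
    qed
    finally show ?thesis .
  qed
  obtain \<delta> where \<delta>: "0 < \<delta>" "\<And>n \<omega>. \<omega> \<in> space M \<Longrightarrow> norm (emp_trans X n \<omega> - P) < \<delta> \<Longrightarrow>
        \<bar>Y n \<omega> - y - C \<bullet> (emp_trans X n \<omega> - P)\<bar> \<le> e * norm (emp_trans X n \<omega> - P)"
    using diff[OF e] by blast
  have "\<forall>\<^sub>F n::nat in sequentially. c / \<delta> + 1 \<le> sqrt n \<and> (1::nat) \<le> n"
    by (intro eventually_conj eventually_ge_at_top
        filterlim_compose[OF sqrt_at_top filterlim_real_sequentially, unfolded filterlim_at_top, rule_format])
  then obtain n0 where n0: "\<And>n::nat. n0 \<le> n \<Longrightarrow> c / \<delta> + 1 \<le> sqrt n \<and> (1::nat) \<le> n"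
    unfolding eventually_sequentially by blast
  have main: "\<bar>sqrt n * (Y n \<omega> - y)
          - path_sum (\<lambda>k l. (C $ k $ l - (\<Sum>l\<in>UNIV. P $ k $ l * C $ k $ l)) / \<pi> $ k) n (\<lambda>l. X l \<omega>) / sqrt n\<bar> \<le> \<epsilon>"
    if n: "n0 \<le> n" and \<omega>: "\<omega> \<in> space M"
      and N: "\<And>i. \<bar>exit_count X n i \<omega> / n - \<pi> $ i\<bar> < \<eta>"
      and R: "\<And>i j. \<bar>path_sum (trans_residual P i j) n (\<lambda>l. X l \<omega>)\<bar> < K * sqrt n" for n \<omega>
  proof -
    have n1: "0 < real n" and sn: "0 < sqrt n" and c\<delta>: "c / sqrt n < \<delta>"
    proof -
      show "0 < real n" using n0[OF n] by simp
      then show "0 < sqrt n" by simp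
      have "c / \<delta> < sqrt n"
        using n0[OF n] by linarith
      then show "c / sqrt n < \<delta>"
        using \<delta>(1) \<open>0 < sqrt n\<close> by (simp add: field_simps)
    qed
    have ss: "sqrt n * sqrt n = n"
      using n1 by simp
    define x where "x i = exit_count X n i \<omega> / n" for i
    define m where "m i j = path_sum (trans_residual P i j) n (\<lambda>l. X l \<omega>)" for i j
    let ?D = "emp_trans X n \<omega> - P"
    have x: "p / 2 \<le> x i" for i
      using N[of i] p(2)[of i] \<eta>p unfolding x_def by linarith
    then have x0: "0 < x i" for i
      using p(1) by (meson half_gt_zero less_le_trans)
    have D: "?D $ i $ j = m i j / (n * x i)" for i j
    proof -
      have nz: "exit_count X n i \<omega> \<noteq> 0"
        using x0[of i] by (cases "exit_count X n i \<omega> = 0") (simp_all add: x_def)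
      have "real n * x i = real (exit_count X n i \<omega>)"
        using n1 by (simp add: x_def)
      then show ?thesis
        by (simp only: emp_trans_minus[OF nz] m_def)
    qed
    have "\<bar>?D $ i $ j\<bar> \<le> 2 * K / p / sqrt n" for i j
    proof -
      have "\<bar>?D $ i $ j\<bar> = \<bar>m i j\<bar> / (n * x i)"
        using n1 x0[of i] by (simp only: D abs_divide abs_mult abs_of_pos)
      also have "\<dots> \<le> (K * sqrt n) / (n * (p / 2))"
        using R[of i j] x[of i] n1 p(1) K by (intro frac_le mult_left_mono) (auto simp: m_def)
      also have "\<dots> = 2 * K / p / sqrt n"
        using sn p(1) by (subst ss[symmetric]) (simp add: field_simps del: real_sqrt_mult_self)
      finally show ?thesis .
    qed
    then have normD: "norm ?D \<le> c / sqrt n"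
      using norm_matrix_le[of ?D "2 * K / p / sqrt n"] by (simp add: c_def)
    then have "\<bar>Y n \<omega> - y - C \<bullet> ?D\<bar> \<le> e * norm ?D"
      using c\<delta> by (intro \<delta>(2)[OF \<omega>]) simp
    also have "\<dots> \<le> e * (c / sqrt n)"
      using e normD by (intro mult_left_mono) auto
    finally have "sqrt n * \<bar>Y n \<omega> - y - C \<bullet> ?D\<bar> \<le> sqrt n * (e * (c / sqrt n))"
      using sn by (intro mult_left_mono) auto
    also have "\<dots> = \<epsilon> / 2"
      using sn c by (simp add: e_def)
    finally have part1: "\<bar>sqrt n * (Y n \<omega> - y - C \<bullet> ?D)\<bar> \<le> \<epsilon> / 2"
      using sn by (simp add: abs_mult)
    let ?g = "\<lambda>k l. (C $ k $ l - (\<Sum>l\<in>UNIV. P $ k $ l * C $ k $ l)) / \<pi> $ k"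
    have g: "?g k l = (\<Sum>i\<in>UNIV. \<Sum>j\<in>UNIV. C $ i $ j / \<pi> $ i * trans_residual P i j k l)" for k l
    proof -
      have "(\<Sum>j\<in>UNIV. C $ i $ j / \<pi> $ i * trans_residual P i j k l) = (if k = i then ?g k l else 0)" for i
        by (auto simp: trans_residual_def of_bool_def right_diff_distrib sum_subtractf
            diff_divide_distrib sum_divide_distrib mult_ac if_distrib[of "\<lambda>x. _ * x"] cong: if_cong)
      then show ?thesis by simp
    qed
    have S: "path_sum ?g n (\<lambda>l. X l \<omega>) = (\<Sum>i\<in>UNIV. \<Sum>j\<in>UNIV. C $ i $ j / \<pi> $ i * m i j)"
    proof -
      have "path_sum ?g n (\<lambda>l. X l \<omega>) = (\<Sum>r<n. \<Sum>i\<in>UNIV. \<Sum>j\<in>UNIV. C $ i $ j / \<pi> $ i * trans_residual P i j (X r \<omega>) (X (Suc r) \<omega>))"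
        unfolding path_sum_def g ..
      also have "\<dots> = (\<Sum>i\<in>UNIV. \<Sum>j\<in>UNIV. \<Sum>r<n. C $ i $ j / \<pi> $ i * trans_residual P i j (X r \<omega>) (X (Suc r) \<omega>))"
        by (subst sum.swap) (intro sum.cong refl sum.swap)
      finally show ?thesis
        by (simp only: m_def path_sum_def sum_distrib_left)
    qed
    have "n * (C \<bullet> ?D) - path_sum ?g n (\<lambda>l. X l \<omega>)
        = (\<Sum>i\<in>UNIV. \<Sum>j\<in>UNIV. C $ i $ j * (m i j / x i - m i j / \<pi> $ i))"
      unfolding S inner_matrix_eq_sum D using n1
      by (simp add: sum_distrib_left sum_subtractf right_diff_distrib)
    also have "\<bar>\<dots>\<bar> \<le> (\<Sum>i\<in>UNIV. \<Sum>j\<in>UNIV. \<bar>C $ i $ j\<bar> * (sqrt n * (2 * K * \<eta> / p\<^sup>2)))"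
    proof (rule order_trans[OF sum_abs], rule sum_mono, rule order_trans[OF sum_abs], rule sum_mono)
      fix i j
      have "m i j / x i - m i j / \<pi> $ i = m i j * (\<pi> $ i - x i) / (x i * \<pi> $ i)"
        using x0[of i] \<pi>[of i] by (simp add: field_simps)
      also have "\<bar>\<dots>\<bar> = \<bar>m i j\<bar> * \<bar>x i - \<pi> $ i\<bar> / (x i * \<pi> $ i)"
        using x0[of i] \<pi>[of i] by (simp add: abs_mult abs_minus_commute)
      also have "\<dots> \<le> (K * sqrt n) * \<eta> / (p / 2 * p)"
        using x[of i] p \<pi>[of i] R[of i j] N[of i] \<eta> K
        by (intro frac_le mult_mono) (auto simp: m_def x_def)
      also have "\<dots> = sqrt n * (2 * K * \<eta> / p\<^sup>2)"
        using p(1) by (simp add: power2_eq_square)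
      finally show "\<bar>C $ i $ j * (m i j / x i - m i j / \<pi> $ i)\<bar> \<le> \<bar>C $ i $ j\<bar> * (sqrt n * (2 * K * \<eta> / p\<^sup>2))"
        unfolding abs_mult by (intro mult_left_mono) auto
    qed
    also have "\<dots> = sqrt n * (B * (2 * K * \<eta> / p\<^sup>2))"
      by (simp only: B_def sum_distrib_right[symmetric] mult.left_commute[of "sqrt n"])
    also have "\<dots> \<le> sqrt n * (\<epsilon> / 2)"
      using sn \<eta>B by (intro mult_left_mono) auto
    finally have part2: "\<bar>(n * (C \<bullet> ?D) - path_sum ?g n (\<lambda>l. X l \<omega>)) / sqrt n\<bar> \<le> \<epsilon> / 2"
      using sn by (simp add: field_simps)
    have eq: "sqrt n * (Y n \<omega> - y) - path_sum ?g n (\<lambda>l. X l \<omega>) / sqrt n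
        = sqrt n * (Y n \<omega> - y - C \<bullet> ?D) + (n * (C \<bullet> ?D) - path_sum ?g n (\<lambda>l. X l \<omega>)) / sqrt n"
    proof -
      have "n * b / sqrt n = sqrt n * b" for b :: real
        by (metis of_nat_0_le_iff real_div_sqrt times_divide_eq_left)
      then show ?thesis
        by (simp add: right_diff_distrib diff_divide_distrib)
    qed
    show ?thesis
      unfolding eq using order_trans[OF abs_triangle_ineq add_mono[OF part1 part2]] by simp
  qed
  show ?thesis
    by (rule that[OF \<eta>]) (rule main)
qed

text \<open>The differentiability hypothesis is stated along the realisations \<open>emp_trans X n \<omega>\<close>, not for a
  function of the matrix.  This lets it cover an estimator that is arbitrary where the empirical
  matrix is far from \<open>P\<close>.\<close>

lemma delta_method_emp_trans:
  fixes Y :: "nat \<Rightarrow> 'a \<Rightarrow> real" and L :: "real ^ 's ^ 's \<Rightarrow> real"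
  assumes P: "stochastic_matrix P" "irreducible_matrix P" and \<pi>: "stationary_vec P \<pi>"
    and W: "limit_matrix P \<pi> N W"
    and Y: "\<And>n. Y n \<in> borel_measurable M" and L: "linear L"
    and diff: "\<And>e. 0 < e \<Longrightarrow> \<exists>\<delta>>0. \<forall>n. \<forall>\<omega>\<in>space M. norm (emp_trans X n \<omega> - P) < \<delta> \<longrightarrow>
        \<bar>Y n \<omega> - y - L (emp_trans X n \<omega> - P)\<bar> \<le> e * norm (emp_trans X n \<omega> - P)"
  shows "weak_conv_m (\<lambda>n. distr M borel (\<lambda>\<omega>. sqrt n * (Y n \<omega> - y))) (distr N borel (\<lambda>\<omega>. L (W \<omega>)))"
proof -
  define C where "C = adjoint L 1"
  have LC: "L H = C \<bullet> H" for H
    using adjoint_works[OF L, of H 1] by (simp add: C_def inner_commute)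
  interpret N: prob_space N
    using W by (simp add: limit_matrix_def)
  have \<pi>0: "0 < \<pi> $ i" for i
    by (rule stationary_vec_pos[OF P \<pi>])
  let ?g = "\<lambda>k l. (C $ k $ l - (\<Sum>l\<in>UNIV. P $ k $ l * C $ k $ l)) / \<pi> $ k"
  let ?A = "\<lambda>n \<omega>. sqrt (real n) * (Y n \<omega> - y)"
  let ?B = "\<lambda>n \<omega>. path_sum ?g n (\<lambda>l. X l \<omega>) / sqrt (real n)"
  have A: "?A n \<in> borel_measurable M" for n
    using Y by measurable
  have psm [measurable]: "(\<lambda>\<omega>. path_sum g n (\<lambda>l. X l \<omega>)) \<in> borel_measurable M" for g n
    by (rule measurable_path_functional[where m=n]) (rule path_sum_cong)
  have B: "?B n \<in> borel_measurable M" for n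
    by measurable
  have LW: "(\<lambda>\<omega>. L (W \<omega>)) \<in> borel_measurable N" and gLW: "gaussian_rv N (\<lambda>\<omega>. L (W \<omega>))"
    using W unfolding limit_matrix_def gaussian_vec_def gaussian_rv_def LC by blast+
  have centred: "(\<Sum>l\<in>UNIV. P $ k $ l * ?g k l) = 0" for k
  proof -
    have "(\<Sum>l\<in>UNIV. P $ k $ l * ?g k l)
        = ((\<Sum>l\<in>UNIV. P $ k $ l * C $ k $ l) - (\<Sum>l\<in>UNIV. P $ k $ l) * (\<Sum>l\<in>UNIV. P $ k $ l * C $ k $ l)) / \<pi> $ k"
      by (simp only: times_divide_eq_right sum_divide_distrib[symmetric] right_diff_distrib
          sum_subtractf sum_distrib_right[symmetric])
    then show ?thesis
      using P by (simp add: stochastic_matrix_def)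
  qed
  have charW: "(LINT \<omega>|N. iexp (t * L (W \<omega>)))
      = of_real (exp (- (t\<^sup>2 * (\<Sum>i\<in>UNIV. \<pi> $ i * (\<Sum>j\<in>UNIV. P $ i $ j * (?g i j)\<^sup>2)) / 2)))" for t
  proof -
    note m = limit_matrix_moments[OF W \<pi>0 P(1), of C]
    have "(LINT \<omega>|N. L (W \<omega>)) = 0"
      unfolding LC by (rule m)
    from char_centred_gaussian_rv[OF N.prob_space_axioms gLW this, of t]
    show ?thesis
      unfolding LC m(2) .
  qed
  have close: "(\<lambda>n. \<P>(\<omega> in M. \<epsilon> < \<bar>?A n \<omega> - ?B n \<omega>\<bar>)) \<longlonglongrightarrow> 0" if \<epsilon>: "0 < \<epsilon>" for \<epsilon>
  proof (rule LIMSEQ_I)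
    fix \<rho> :: real assume \<rho>: "0 < \<rho>"
    define s where "s = real CARD('s \<times> 's)"
    have s: "0 < s" by (simp add: s_def)
    (* By Chebyshev each of the s residual sums exceeds K sqrt n with probability at most 1 / K^2,
       so all of them together cost \<rho> / 2. *)
    define K where "K = sqrt (2 * s / \<rho>)"
    have K: "0 < K" and sK: "s / K\<^sup>2 = \<rho> / 2"
      using s \<rho> by (simp_all add: K_def)
    obtain \<eta> n0 where \<eta>: "0 < \<eta>" and n0: "\<And>n \<omega>. \<lbrakk>n0 \<le> n; \<omega> \<in> space M; \<And>i. \<bar>exit_count X n i \<omega> / n - \<pi> $ i\<bar> < \<eta>;
        \<And>i j. \<bar>path_sum (trans_residual P i j) n (\<lambda>l. X l \<omega>)\<bar> < K * sqrt n\<rbrakk>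
      \<Longrightarrow> \<bar>?A n \<omega> - ?B n \<omega>\<bar> \<le> \<epsilon>"
      by (rule linearisation_error[OF \<pi>0 diff[unfolded LC] \<epsilon> K]) blast+
    let ?E = "\<lambda>n i. {\<omega> \<in> space M. \<eta> \<le> \<bar>exit_count X n i \<omega> / n - \<pi> $ i\<bar>}"
    let ?F = "\<lambda>n q. {\<omega> \<in> space M. K * sqrt (real n) \<le> \<bar>path_sum (trans_residual P (fst q) (snd q)) n (\<lambda>l. X l \<omega>)\<bar>}"
    have E: "?E n i \<in> sets M" for n i
    proof -
      have "(\<lambda>\<omega>. real (exit_count X n i \<omega>)) \<in> borel_measurable M"
        unfolding exit_count_eq_sum
        by (rule measurable_path_functional[where m=n and \<phi>="\<lambda>x. \<Sum>m<n. of_bool (x m = i)"]) simp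
      then show ?thesis by measurable
    qed
    have F: "?F n q \<in> sets M" for n q
      by measurable
    have bound: "\<P>(\<omega> in M. \<epsilon> < \<bar>?A n \<omega> - ?B n \<omega>\<bar>) \<le> (\<Sum>i\<in>UNIV. measure M (?E n i)) + \<rho> / 2"
      if n: "max 1 n0 \<le> n" for n
    proof -
      have sub: "{\<omega> \<in> space M. \<epsilon> < \<bar>?A n \<omega> - ?B n \<omega>\<bar>} \<subseteq> (\<Union>i. ?E n i) \<union> (\<Union>q. ?F n q)"
      proof
        fix \<omega> assume w: "\<omega> \<in> {\<omega> \<in> space M. \<epsilon> < \<bar>?A n \<omega> - ?B n \<omega>\<bar>}"
        show "\<omega> \<in> (\<Union>i. ?E n i) \<union> (\<Union>q. ?F n q)"
        proof (rule ccontr)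
          assume not: "\<not> ?thesis"
          have "\<bar>?A n \<omega> - ?B n \<omega>\<bar> \<le> \<epsilon>"
          proof (rule n0)
            show "n0 \<le> n" "\<omega> \<in> space M" using n w by auto
            show "\<bar>exit_count X n i \<omega> / n - \<pi> $ i\<bar> < \<eta>" for i
            proof (rule ccontr)
              assume "\<not> ?thesis"
              then have "\<omega> \<in> ?E n i"
                using w by simp
              then show False using not by blast
            qed
            show "\<bar>path_sum (trans_residual P i j) n (\<lambda>l. X l \<omega>)\<bar> < K * sqrt n" for i j
            proof (rule ccontr)
              assume "\<not> ?thesis"
              then have "\<omega> \<in> ?F n (i, j)"
                using w by simp
              then show False using not by blast
            qed
          qed
          then show False using w by simp
        qed
      qed
      have UE: "(\<Union>i. ?E n i) \<in> sets M" and UF: "(\<Union>q. ?F n q) \<in> sets M"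
        by (rule sets.finite_UN[OF finite E], rule sets.finite_UN[OF finite F])
      have "\<P>(\<omega> in M. \<epsilon> < \<bar>?A n \<omega> - ?B n \<omega>\<bar>) \<le> measure M ((\<Union>i. ?E n i) \<union> (\<Union>q. ?F n q))"
        by (rule finite_measure_mono[OF sub sets.Un[OF UE UF]])
      also have "\<dots> \<le> measure M (\<Union>i. ?E n i) + measure M (\<Union>q. ?F n q)"
        by (rule measure_Un_le[OF UE UF])
      also have "\<dots> \<le> (\<Sum>i\<in>UNIV. measure M (?E n i)) + (\<Sum>q\<in>UNIV. measure M (?F n q))"
        by (intro add_mono finite_measure_subadditive_finite) (use E F in auto)
      also have "(\<Sum>q\<in>UNIV. measure M (?F n q)) \<le> (\<Sum>q\<in>(UNIV :: ('s \<times> 's) set). 1 / K\<^sup>2)"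
      proof (rule sum_mono)
        fix q
        have n1: "0 < real n" using n by simp
        have "measure M (?F n q) \<le> real n * 1\<^sup>2 / (K * sqrt n)\<^sup>2"
          by (rule prob_path_sum_ge[OF trans_residual_centred[OF P(1)] trans_residual_bound[OF P(1)]])
             (use K n1 in simp)
        also have "\<dots> = 1 / K\<^sup>2"
          using n1 by (simp add: power_mult_distrib)
        finally show "measure M (?F n q) \<le> 1 / K\<^sup>2" .
      qed
      also have "(\<Sum>q\<in>(UNIV :: ('s \<times> 's) set). 1 / K\<^sup>2) = s / K\<^sup>2"
        by (simp add: s_def)
      finally show ?thesis
        unfolding sK by simp
    qed
    have "(\<lambda>n. \<Sum>i\<in>UNIV. measure M (?E n i)) \<longlonglongrightarrow> (\<Sum>i\<in>(UNIV :: 's set). 0)"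
      by (intro tendsto_sum occupation_lln[OF P \<pi> \<eta>])
    moreover have "0 < \<rho> / 2"
      using \<rho> by simp
    ultimately have "\<exists>n1. \<forall>n\<ge>n1. norm ((\<Sum>i\<in>UNIV. measure M (?E n i)) - (\<Sum>i\<in>(UNIV :: 's set). 0)) < \<rho> / 2"
      by (rule LIMSEQ_D)
    then obtain n1 where n1: "\<And>n. n1 \<le> n \<Longrightarrow> norm ((\<Sum>i\<in>UNIV. measure M (?E n i)) - (\<Sum>i\<in>(UNIV :: 's set). 0)) < \<rho> / 2"
      by blast
    have "norm (\<P>(\<omega> in M. \<epsilon> < \<bar>?A n \<omega> - ?B n \<omega>\<bar>) - 0) < \<rho>" if n: "max n1 (max 1 n0) \<le> n" for n
    proof -
      have "\<bar>\<Sum>i\<in>UNIV. measure M (?E n i)\<bar> < \<rho> / 2"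
        using n1[of n] n by (simp only: sum.neutral_const diff_0_right real_norm_def max.bounded_iff)
      then have "(\<Sum>i\<in>UNIV. measure M (?E n i)) < \<rho> / 2"
        by (rule le_less_trans[OF abs_ge_self])
      moreover have "\<P>(\<omega> in M. \<epsilon> < \<bar>?A n \<omega> - ?B n \<omega>\<bar>) \<le> (\<Sum>i\<in>UNIV. measure M (?E n i)) + \<rho> / 2"
        by (rule bound) (use n in simp)
      ultimately show ?thesis
        by simp
    qed
    then show "\<exists>n2. \<forall>n\<ge>n2. norm (\<P>(\<omega> in M. \<epsilon> < \<bar>?A n \<omega> - ?B n \<omega>\<bar>) - 0) < \<rho>"
      by blast
  qed
  show ?thesis
  proof (rule levy_continuity)
    show "real_distribution (distr M borel (?A n))" for n
      by (rule real_distribution_distr[OF A])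
    show "real_distribution (distr N borel (\<lambda>\<omega>. L (W \<omega>)))"
      by (rule N.real_distribution_distr[OF LW])
    fix t
    have "(\<lambda>n. LINT \<omega>|M. iexp (t * ?A n \<omega>)) \<longlonglongrightarrow> (LINT \<omega>|N. iexp (t * L (W \<omega>)))"
      unfolding charW
      by (rule char_tendsto_slutsky[OF A B close char_path_sum_tendsto[OF P \<pi> centred]])
    moreover have "char (distr M borel (?A n)) t = (LINT \<omega>|M. iexp (t * ?A n \<omega>))" for n
      unfolding char_def by (rule integral_distr[OF A]) measurable
    moreover have "char (distr N borel (\<lambda>\<omega>. L (W \<omega>))) t = (LINT \<omega>|N. iexp (t * L (W \<omega>)))"
      unfolding char_def by (rule integral_distr[OF LW]) measurable
    ultimately show "(\<lambda>n. char (distr M borel (?A n)) t) \<longlonglongrightarrow> char (distr N borel (\<lambda>\<omega>. L (W \<omega>))) t"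
      by (simp only:)
  qed
qed

end

section \<open>Derivatives of the two functionals\<close>

lemma matpow_commute: "matpow P n ** P = P ** matpow P n"
  by (induction n) (simp_all add: matrix_mul_assoc[symmetric])

lemma ind_diag_mult_vector_nth: "(ind_diag U *v y) $ i = indicator U i * y $ i"
  by (simp add: ind_diag_def matrix_vector_mult_def mult_delta_left)

context finite_markov_chain
begin

lemma expectation_X:
  "(LINT \<omega>|M. f $ X m \<omega>) = (a v* matpow P m) \<bullet> f"
proof (induction m arbitrary: f)
  case 0
  have ev: "{\<omega> \<in> space M. X 0 \<omega> = i} \<in> sets M" for i
    using measurable_X by measurable
  have "(LINT \<omega>|M. f $ X 0 \<omega>) = (LINT \<omega>|M. (\<Sum>i\<in>UNIV. indicator {\<omega> \<in> space M. X 0 \<omega> = i} \<omega> *\<^sub>R f $ i))"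
    by (rule Bochner_Integration.integral_cong[OF refl]) (simp add: indicator_def if_distrib[of "\<lambda>x. x * _"] cong: if_cong)
  also have "\<dots> = (\<Sum>i\<in>UNIV. measure M {\<omega> \<in> space M. X 0 \<omega> = i} *\<^sub>R f $ i)"
    by (rule integral_indicator_sum) (use ev in auto)
  also have "\<dots> = a \<bullet> f"
    by (simp add: initial_law inner_vec_def)
  finally show ?case by simp
next
  case (Suc m)
  have "(LINT \<omega>|M. f $ X (Suc m) \<omega>) = (LINT \<omega>|M. (\<Sum>j\<in>UNIV. P $ X m \<omega> $ j *\<^sub>R f $ j))"
    by (rule integral_markov[where m=m and \<phi>="\<lambda>x j. f $ j"]) simp
  also have "\<dots> = (LINT \<omega>|M. (P *v f) $ X m \<omega>)"
    by (simp add: matrix_vector_mult_def)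
  also have "\<dots> = (a v* matpow P m) \<bullet> (P *v f)"
    by (rule Suc)
  also have "\<dots> = (a v* matpow P (Suc m)) \<bullet> f"
    by (simp only: dot_lmul_matrix[symmetric] vector_matrix_mul_assoc matpow.simps matpow_commute)
  finally show ?case .
qed

lemma prob_enter_eq_rocof:
  assumes "1 \<le> k"
  shows "\<P>(\<omega> in M. X (k - 1) \<omega> \<in> U \<and> X k \<omega> \<in> D) = rocof a U D k P"
proof -
  obtain m where k: "k = Suc m"
    using assms by (cases k) auto
  have ev: "{\<omega> \<in> space M. X m \<omega> \<in> U \<and> X (Suc m) \<omega> \<in> D} \<in> sets M"
  proof -
    have [measurable]: "X l \<in> M \<rightarrow>\<^sub>M count_space UNIV" for l
      by (rule measurable_X)
    show ?thesis by measurable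
  qed
  have "\<P>(\<omega> in M. X m \<omega> \<in> U \<and> X (Suc m) \<omega> \<in> D)
      = (LINT \<omega>|M. indicator {\<omega> \<in> space M. X m \<omega> \<in> U \<and> X (Suc m) \<omega> \<in> D} \<omega>)"
    using ev by simp
  also have "\<dots> = (LINT \<omega>|M. indicator U (X m \<omega>) * indicator D (X (Suc m) \<omega>))"
    by (rule Bochner_Integration.integral_cong[OF refl]) (simp add: indicator_def)
  also have "\<dots> = (LINT \<omega>|M. (\<Sum>j\<in>UNIV. P $ X m \<omega> $ j *\<^sub>R (indicator U (X m \<omega>) * indicator D j)))"
    by (rule integral_markov[where m=m and \<phi>="\<lambda>x j. indicator U (x m) * indicator D j"]) simp
  also have "\<dots> = (LINT \<omega>|M. (ind_diag U *v (P *v ind_vec D)) $ X m \<omega>)"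
    unfolding ind_diag_mult_vector_nth
    by (simp only: matrix_vector_mult_def vec_lambda_beta ind_vec_def sum_distrib_left
         real_scaleR_def mult_ac)
  also have "\<dots> = rocof a U D k P"
    unfolding expectation_X rocof_def k
    by (simp add: dot_lmul_matrix matrix_vector_mul_assoc[symmetric] flip: vector_matrix_mul_assoc)
  finally show ?thesis by (simp add: k)
qed

end

lemma bounded_bilinear_matrix_mult:
  "bounded_bilinear ((**) :: real ^ 'n::finite ^ 'm::finite \<Rightarrow> real ^ 'k::finite ^ 'n \<Rightarrow> real ^ 'k ^ 'm)"
  unfolding bilinear_conv_bounded_bilinear[symmetric] bilinear_def
  by (auto intro!: linearI simp: vec_eq_iff
      matrix_matrix_mult_def sum_distrib_left sum.distrib algebra_simps)

lemma bounded_bilinear_vector_matrix_mult: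
  "bounded_bilinear ((v*) :: real ^ 'm::finite \<Rightarrow> real ^ 'n::finite ^ 'm \<Rightarrow> real ^ 'n)"
  unfolding bilinear_conv_bounded_bilinear[symmetric] bilinear_def
  by (auto intro!: linearI simp: vec_eq_iff vector_matrix_mult_def sum_distrib_left sum.distrib algebra_simps)

lemma W_pow_Suc: "W_pow P H (Suc k) = H ** matpow P k + P ** W_pow P H k"
proof -
  have "(\<Sum>i<k. matpow P (Suc i) ** H ** matpow P (Suc k - 1 - Suc i))
      = (\<Sum>i<k. P ** (matpow P i ** H ** matpow P (k - 1 - i)))"
    by (intro sum.cong refl) (simp add: matrix_mul_assoc)
  also have "\<dots> = P ** (\<Sum>i<k. matpow P i ** H ** matpow P (k - 1 - i))"
    by (simp add: bounded_bilinear.sum_right[OF bounded_bilinear_matrix_mult])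
  finally show ?thesis
    unfolding W_pow_def sum.lessThan_Suc_shift by simp
qed

text \<open>The product rule for \<open>P ** matpow P k\<close> produces the recursion \<open>W_pow_Suc\<close>.\<close>

lemma has_derivative_matpow:
  "((\<lambda>Q. matpow Q k) has_derivative (\<lambda>H. W_pow P H k)) (at P)"
proof (induction k)
  case 0
  then show ?case by (simp add: W_pow_def)
next
  case (Suc k)
  have "((\<lambda>Q. Q ** matpow Q k) has_derivative (\<lambda>H. P ** W_pow P H k + H ** matpow P k)) (at P)"
    by (rule bounded_bilinear.FDERIV[OF bounded_bilinear_matrix_mult has_derivative_ident Suc])
  then show ?case
    by (simp add: W_pow_Suc add.commute)
qed

lemma has_derivative_rocof:
  "(rocof a U D k has_derivative
     (\<lambda>H. (a v* (W_pow P H (k - 1) ** ind_diag U ** P + matpow P (k - 1) ** ind_diag U ** H)) \<bullet> ind_vec D)) (at P)"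
proof -
  note mult = bounded_bilinear.FDERIV[OF bounded_bilinear_matrix_mult]
  have "((\<lambda>Q. matpow Q (k - 1) ** ind_diag U) has_derivative
      (\<lambda>H. matpow P (k - 1) ** 0 + W_pow P H (k - 1) ** ind_diag U)) (at P)"
    by (rule mult[OF has_derivative_matpow has_derivative_const])
  then have "((\<lambda>Q. matpow Q (k - 1) ** ind_diag U ** Q) has_derivative
      (\<lambda>H. matpow P (k - 1) ** ind_diag U ** H + (matpow P (k - 1) ** 0 + W_pow P H (k - 1) ** ind_diag U) ** P)) (at P)"
    by (rule mult[OF _ has_derivative_ident])
  moreover have "bounded_linear (\<lambda>Q. (a v* Q) \<bullet> ind_vec D)"
    by (rule bounded_linear_compose[OF bounded_linear_inner_left
          bounded_bilinear.bounded_linear_right[OF bounded_bilinear_vector_matrix_mult]])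
  ultimately have "((\<lambda>Q. (a v* (matpow Q (k - 1) ** ind_diag U ** Q)) \<bullet> ind_vec D) has_derivative
      (\<lambda>H. (a v* (matpow P (k - 1) ** ind_diag U ** H + (matpow P (k - 1) ** 0 + W_pow P H (k - 1) ** ind_diag U) ** P)) \<bullet> ind_vec D)) (at P)"
    by (rule bounded_linear.has_derivative[rotated])
  then show ?thesis
    unfolding rocof_def[abs_def]
    by (simp add: add.commute bounded_bilinear.zero_right[OF bounded_bilinear_matrix_mult])
qed

text \<open>Put \<open>H = Q - P\<close> and \<open>Y = (I - P + A)\<^sup>-\<^sup>1\<close>.  The equation \<open>p (I - Q + A) = 1\<close> is equivalent to
  \<open>p = \<pi> + p H Y\<close>.  For small \<open>H\<close> the map \<open>x \<mapsto> x H Y\<close> is a contraction; this makes \<open>I - Q + A\<close>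
  invertible, gives \<open>p - \<pi> = O(H)\<close>, and leaves the remainder \<open>(p - \<pi>) H Y = O(H\<^sup>2)\<close> of the linear
  part \<open>\<pi> H Y\<close>.  Invertibility of \<open>I - Q + A\<close> is a conclusion here: outside this neighbourhood
  \<open>p\<close> need not be related to \<open>Q\<close>.\<close>

lemma stationary_vec_perturbation:
  fixes P :: "real ^ 's::finite ^ 's"
  assumes P: "stochastic_matrix P" "irreducible_matrix P" and \<pi>: "stationary_vec P \<pi>"
  obtains K where "0 < K"
    and "\<And>Q p. \<lbrakk>K * norm (Q - P) \<le> 1; invertible (mat 1 - Q + all_ones) \<Longrightarrow> p = 1 v* matrix_inv (mat 1 - Q + all_ones)\<rbrakk>
        \<Longrightarrow> norm (p - \<pi> - \<pi> v* ((Q - P) ** matrix_inv (mat 1 - P + all_ones))) \<le> K * (norm (Q - P))\<^sup>2"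
proof -
  let ?Z = "mat 1 - P + all_ones"
  let ?Y = "matrix_inv ?Z"
  have invZ: "invertible ?Z" and \<pi>Y: "\<pi> = 1 v* ?Y"
    by (rule stationary_vec_formula[OF P \<pi>])+
  have ZY: "?Z ** ?Y = mat 1"
    using invZ unfolding invertible_def matrix_inv_def by (rule someI2_ex) blast
  have YZ: "?Y ** ?Z = mat 1"
    using invZ unfolding invertible_def matrix_inv_def by (rule someI2_ex) blast
  have \<pi>Z: "\<pi> v* ?Z = 1"
    by (simp add: \<pi>Y vector_matrix_mul_assoc YZ)
  obtain c where c: "0 < c" "\<And>(x :: real ^ 's) (H :: real ^ 's ^ 's). norm (x v* (H ** ?Y)) \<le> c * norm x * norm H"
  proof -
    obtain b1 where b1: "0 < b1" "\<And>(x :: real ^ 's) (H :: real ^ 's ^ 's). norm (x v* H) \<le> norm x * norm H * b1"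
      using bounded_bilinear.pos_bounded[OF bounded_bilinear_vector_matrix_mult] by blast
    obtain b2 where b2: "0 < b2" "\<And>(H :: real ^ 's ^ 's) (G :: real ^ 's ^ 's). norm (H ** G) \<le> norm H * norm G * b2"
      using bounded_bilinear.pos_bounded[OF bounded_bilinear_matrix_mult] by blast
    have "norm (x v* (H ** ?Y)) \<le> (b1 * b2 * (norm ?Y + 1)) * norm x * norm H" for x :: "real ^ 's" and H :: "real ^ 's ^ 's"
    proof -
      have "norm (x v* (H ** ?Y)) \<le> norm x * norm (H ** ?Y) * b1"
        by (rule b1)
      also have "\<dots> \<le> norm x * (norm H * norm ?Y * b2) * b1"
        using b1(1) b2 by (intro mult_right_mono mult_left_mono) auto
      also have "\<dots> = (b1 * b2 * norm ?Y) * (norm x * norm H)"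
        by (simp only: mult_ac)
      also have "\<dots> \<le> (b1 * b2 * (norm ?Y + 1)) * (norm x * norm H)"
        using b1(1) b2(1) by (intro mult_right_mono mult_left_mono) auto
      finally show ?thesis
        by (simp only: mult.assoc)
    qed
    moreover have "0 < b1 * b2 * (norm ?Y + 1)"
      using b1(1) b2(1) by (intro mult_pos_pos add_nonneg_pos) auto
    ultimately show ?thesis
      using that by blast
  qed
  define K where "K = 2 * c + 2 * c\<^sup>2 * norm \<pi>"
  have "2 * c \<le> K"
    by (simp add: K_def)
  have rem: "norm (p - \<pi> - \<pi> v* ((Q - P) ** ?Y)) \<le> K * (norm (Q - P))\<^sup>2"
    if small: "K * norm (Q - P) \<le> 1"
      and p: "invertible (mat 1 - Q + all_ones) \<Longrightarrow> p = 1 v* matrix_inv (mat 1 - Q + all_ones)" for Q p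
  proof -
    let ?H = "Q - P" and ?ZQ = "mat 1 - Q + all_ones"
    have ZQ: "?ZQ = ?Z - ?H"
      by simp
    have "2 * c * norm ?H \<le> K * norm ?H"
      using \<open>2 * c \<le> K\<close> by (intro mult_right_mono) auto
    then have half: "c * norm ?H \<le> 1 / 2"
      using small by linarith
    have half': "norm (x v* (?H ** ?Y)) \<le> 1 / 2 * norm x" for x :: "real ^ 's"
    proof -
      have "norm (x v* (?H ** ?Y)) \<le> c * norm x * norm ?H"
        by (rule c)
      also have "\<dots> = c * norm ?H * norm x"
        by (simp only: mult_ac)
      also have "\<dots> \<le> 1 / 2 * norm x"
        using half by (intro mult_right_mono) auto
      finally show ?thesis .
    qed
    have solve: "x = y v* ?Y + x v* (?H ** ?Y)" if "x v* ?ZQ = y" for x y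
    proof -
      have "x v* ?Z = y + x v* ?H"
        using that by (simp add: ZQ vector_matrix_mult_diff_rdistrib algebra_simps del: diff_add_eq)
      then have "(x v* ?Z) v* ?Y = y v* ?Y + (x v* ?H) v* ?Y"
        by (simp add: vector_matrix_left_distrib)
      then show ?thesis
        by (simp add: vector_matrix_mul_assoc ZY)
    qed
    have ker: "x = 0" if "x v* ?ZQ = 0" for x
      using solve[OF that] half'[of x] by simp
    have "invertible ?ZQ"
    proof -
      have "invertible (transpose ?ZQ)"
        unfolding invertible_left_inverse matrix_left_invertible_ker
        using ker by (simp add: transpose_matrix_vector)
      then show ?thesis
        by (metis transpose_invertible transpose_transpose)
    qed
    note invQ = this
    then have "matrix_inv ?ZQ ** ?ZQ = mat 1"
      unfolding invertible_def matrix_inv_def by (rule someI2_ex) blast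
    then have pZ: "p v* ?ZQ = 1"
      using p[OF invQ] by (simp add: vector_matrix_mul_assoc)
    have p\<pi>: "p - \<pi> = p v* (?H ** ?Y)"
      using solve[OF pZ] \<pi>Y by (metis add_diff_cancel_left')
    have r: "p - \<pi> - \<pi> v* (?H ** ?Y) = (p - \<pi>) v* (?H ** ?Y)"
      by (simp only: vector_matrix_mult_diff_distrib p\<pi>[symmetric])
    have "p - \<pi> = \<pi> v* (?H ** ?Y) + (p - \<pi>) v* (?H ** ?Y)"
      by (simp only: r[symmetric]) simp
    then have "norm (p - \<pi>) \<le> norm (\<pi> v* (?H ** ?Y)) + norm ((p - \<pi>) v* (?H ** ?Y))"
      by (metis norm_triangle_ineq)
    also have "\<dots> \<le> c * norm \<pi> * norm ?H + 1 / 2 * norm (p - \<pi>)"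
      by (intro add_mono c half')
    finally have d: "norm (p - \<pi>) \<le> 2 * (c * norm \<pi> * norm ?H)"
      by simp
    have "norm ((p - \<pi>) v* (?H ** ?Y)) \<le> c * norm (p - \<pi>) * norm ?H"
      by (rule c)
    also have "\<dots> \<le> c * (2 * (c * norm \<pi> * norm ?H)) * norm ?H"
      using c(1) d by (intro mult_right_mono mult_left_mono) auto
    also have "\<dots> = (2 * c\<^sup>2 * norm \<pi>) * (norm ?H)\<^sup>2"
      by (simp add: power2_eq_square)
    also have "\<dots> \<le> K * (norm ?H)\<^sup>2"
      using c(1) by (intro mult_right_mono) (auto simp: K_def)
    finally show ?thesis
      unfolding r .
  qed
  have "0 < K"
    using c(1) \<open>2 * c \<le> K\<close> by linarith
  then show ?thesis
    by (rule that) (rule rem)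
qed

section \<open>Limit laws of the two estimators\<close>

context finite_markov_chain
begin

text \<open>The empirical matrix is a function of \<open>X\<^sub>0, \<dots>, X\<^sub>n\<close>.\<close>

lemma measurable_emp_trans: "emp_trans X n \<in> borel_measurable M"
proof -
  let ?\<phi> = "\<lambda>x :: nat \<Rightarrow> 's. (\<chi> i j. let e = (\<Sum>m<n. of_bool (x m = i)) in
      if e = 0 then 0 else (\<Sum>m<n. of_bool (x m = i) * of_bool (x (Suc m) = j)) / e) :: real ^ 's ^ 's"
  have "emp_trans X n \<omega> = ?\<phi> (\<lambda>l. X l \<omega>)" for \<omega>
    unfolding emp_trans_def Let_def exit_count_eq_sum[symmetric] trans_count_eq_sum[symmetric]
    by simp
  moreover have "(\<lambda>\<omega>. ?\<phi> (\<lambda>l. X l \<omega>)) \<in> borel_measurable M"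
  proof (rule measurable_path_functional[where m=n])
    fix x y :: "nat \<Rightarrow> 's" assume xy: "\<And>l. l \<le> n \<Longrightarrow> x l = y l"
    have "(\<Sum>m<n. of_bool (x m = i)) = (\<Sum>m<n. of_bool (y m = i) :: real)" for i
      by (rule sum.cong) (simp_all add: xy)
    moreover have "(\<Sum>m<n. of_bool (x m = i) * of_bool (x (Suc m) = j))
        = (\<Sum>m<n. of_bool (y m = i) * of_bool (y (Suc m) = j) :: real)" for i j
      by (rule sum.cong) (simp_all add: xy)
    ultimately show "?\<phi> x = ?\<phi> y"
      by (simp only:)
  qed
  ultimately show ?thesis
    by (simp add: fun_eq_iff[symmetric] cong: measurable_cong)
qed

lemma weak_conv_rocof:
  assumes P: "stochastic_matrix P" "irreducible_matrix P" and \<pi>: "stationary_vec P \<pi>"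
    and W: "limit_matrix P \<pi> N W"
  shows "weak_conv_m
        (\<lambda>n. distr M borel (\<lambda>\<omega>. sqrt (real n) * (rocof b U D k (emp_trans X n \<omega>) - rocof b U D k P)))
        (distr N borel (\<lambda>\<omega>. (b v* (W_pow P (W \<omega>) (k - 1) ** ind_diag U ** P
                                    + matpow P (k - 1) ** ind_diag U ** W \<omega>)) \<bullet> ind_vec D))"
proof -
  note deriv = has_derivative_rocof[of b U D k]
  have "continuous_on UNIV (rocof b U D k)"
    by (intro continuous_at_imp_continuous_on ballI has_derivative_continuous[OF deriv])
  then have meas: "(\<lambda>\<omega>. rocof b U D k (emp_trans X n \<omega>)) \<in> borel_measurable M" for n
    by (rule measurable_compose[OF measurable_emp_trans borel_measurable_continuous_onI])
  let ?L = "\<lambda>H. (b v* (W_pow P H (k - 1) ** ind_diag U ** P + matpow P (k - 1) ** ind_diag U ** H)) \<bullet> ind_vec D"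
  show ?thesis
  proof (rule delta_method_emp_trans[OF P \<pi> W meas, where L="?L"])
    show "linear ?L"
      by (rule has_derivative_linear[OF deriv])
    fix e :: real assume "0 < e"
    then obtain \<delta> where \<delta>: "0 < \<delta>" "\<And>Q. norm (Q - P) < \<delta> \<Longrightarrow>
        norm (rocof b U D k Q - rocof b U D k P - ?L (Q - P)) \<le> e * norm (Q - P)"
      using deriv[of P] unfolding has_derivative_at_alt by blast
    then show "\<exists>\<delta>>0. \<forall>n. \<forall>\<omega>\<in>space M. norm (emp_trans X n \<omega> - P) < \<delta> \<longrightarrow>
        \<bar>rocof b U D k (emp_trans X n \<omega>) - rocof b U D k P - ?L (emp_trans X n \<omega> - P)\<bar>
          \<le> e * norm (emp_trans X n \<omega> - P)"
      by (metis real_norm_def)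
  qed
qed

lemma weak_conv_stationary_plugin:
  assumes P: "stochastic_matrix P" "irreducible_matrix P" and \<pi>: "stationary_vec P \<pi>"
    and W: "limit_matrix P \<pi> N W"
    and meas: "\<And>n. pihat n \<in> borel_measurable M"
    and plugin: "\<And>n \<omega>. \<omega> \<in> space M \<Longrightarrow> invertible (mat 1 - emp_trans X n \<omega> + all_ones) \<Longrightarrow>
           pihat n \<omega> = 1 v* matrix_inv (mat 1 - emp_trans X n \<omega> + all_ones)"
  shows "weak_conv_m
        (\<lambda>n. distr M borel (\<lambda>\<omega>. sqrt (real n) * (pihat n \<omega> \<bullet> u - \<pi> \<bullet> u)))
        (distr N borel (\<lambda>\<omega>. (\<pi> v* (W \<omega> ** matrix_inv (mat 1 - P + all_ones))) \<bullet> u))"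
proof -
  let ?Y = "matrix_inv (mat 1 - P + all_ones)"
  let ?L = "\<lambda>H. (\<pi> v* (H ** ?Y)) \<bullet> u"
  obtain K where K: "0 < K" "\<And>Q p. \<lbrakk>K * norm (Q - P) \<le> 1; invertible (mat 1 - Q + all_ones) \<Longrightarrow> p = 1 v* matrix_inv (mat 1 - Q + all_ones)\<rbrakk>
        \<Longrightarrow> norm (p - \<pi> - \<pi> v* ((Q - P) ** ?Y)) \<le> K * (norm (Q - P))\<^sup>2"
    using stationary_vec_perturbation[OF P \<pi>] by blast
  have bl: "bounded_linear ?L"
    by (rule bounded_linear_compose[OF bounded_linear_inner_left
          bounded_linear_compose[OF bounded_bilinear.bounded_linear_right[OF bounded_bilinear_vector_matrix_mult]
            bounded_bilinear.bounded_linear_left[OF bounded_bilinear_matrix_mult]]])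
  show ?thesis
  proof (rule delta_method_emp_trans[OF P \<pi> W, where L="?L"])
    show "(\<lambda>\<omega>. pihat n \<omega> \<bullet> u) \<in> borel_measurable M" for n
      using meas by measurable
    show "linear ?L"
      by (rule bounded_linear.linear[OF bl])
    fix e :: real assume e: "0 < e"
    define \<delta> where "\<delta> = min (1 / K) (e / (K * (norm u + 1)))"
    have u: "0 < norm u + 1"
      by (rule add_nonneg_pos) auto
    have \<delta>: "0 < \<delta>"
      using K(1) e u by (simp add: \<delta>_def)
    have "\<bar>pihat n \<omega> \<bullet> u - \<pi> \<bullet> u - ?L (emp_trans X n \<omega> - P)\<bar> \<le> e * norm (emp_trans X n \<omega> - P)"
      if \<omega>: "\<omega> \<in> space M" and small: "norm (emp_trans X n \<omega> - P) < \<delta>" for n \<omega>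
    proof -
      let ?D = "emp_trans X n \<omega> - P"
      let ?r = "pihat n \<omega> - \<pi> - \<pi> v* (?D ** ?Y)"
      have K1: "K * norm ?D \<le> 1" and K2: "K * norm ?D * norm u \<le> e"
      proof -
        show "K * norm ?D \<le> 1"
          using small K(1) by (simp add: \<delta>_def field_simps)
        have "K * norm ?D \<le> K * (e / (K * (norm u + 1)))"
          using small K(1) by (intro mult_left_mono) (auto simp: \<delta>_def)
        also have "\<dots> = e / (norm u + 1)"
          using K(1) by simp
        finally have "K * norm ?D \<le> e / (norm u + 1)" .
        then have "K * norm ?D * norm u \<le> e / (norm u + 1) * (norm u + 1)"
          using K(1) e u by (intro mult_mono) auto
        then show "K * norm ?D * norm u \<le> e"
          using u by simp
      qed
      have "\<bar>pihat n \<omega> \<bullet> u - \<pi> \<bullet> u - ?L ?D\<bar> = \<bar>?r \<bullet> u\<bar>"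
        by (simp add: inner_diff_left)
      also have "\<dots> \<le> norm ?r * norm u"
        by (rule Cauchy_Schwarz_ineq2)
      also have "\<dots> \<le> K * (norm ?D)\<^sup>2 * norm u"
        by (intro mult_right_mono K(2)[OF K1 plugin[OF \<omega>]]) auto
      also have "\<dots> = (K * norm ?D * norm u) * norm ?D"
        by (simp add: power2_eq_square)
      also have "\<dots> \<le> e * norm ?D"
        by (intro mult_right_mono K2) auto
      finally show ?thesis .
    qed
    with \<delta> show "\<exists>\<delta>>0. \<forall>n. \<forall>\<omega>\<in>space M. norm (emp_trans X n \<omega> - P) < \<delta> \<longrightarrow>
        \<bar>pihat n \<omega> \<bullet> u - \<pi> \<bullet> u - ?L (emp_trans X n \<omega> - P)\<bar> \<le> e * norm (emp_trans X n \<omega> - P)"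
      by blast
  qed
qed

end

theorem proposition12:
  fixes M :: "'a measure" and X :: "nat \<Rightarrow> 'a \<Rightarrow> 's::finite"
    and P :: "real ^ 's ^ 's" and a \<pi> :: "real ^ 's"
    and N :: "'b measure" and W :: "'b \<Rightarrow> real ^ 's ^ 's"
    and st :: "nat \<Rightarrow> 's" and r :: nat and U D :: "'s set"
    and pihat :: "nat \<Rightarrow> 'a \<Rightarrow> real ^ 's"
  assumes "stochastic_matrix P" and "irreducible_matrix P" and "stationary_vec P \<pi>"
    and "finite_markov_chain M X P a"
    and "bij_betw st {1..CARD('s)} UNIV"
    and "1 \<le> r" and "r \<le> CARD('s) - 1"
    and "U = st ` {1..r}" and "D = st ` {r+1..CARD('s)}"
    and "limit_matrix P \<pi> N W"
    and "\<And>n. pihat n \<in> borel_measurable M"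
    and "\<And>n \<omega>. \<omega> \<in> space M \<Longrightarrow> invertible (mat 1 - emp_trans X n \<omega> + all_ones) \<Longrightarrow>
           pihat n \<omega> = 1 v* matrix_inv (mat 1 - emp_trans X n \<omega> + all_ones)"
  shows "(\<forall>k\<ge>1.
      \<P>(\<omega> in M. X (k - 1) \<omega> \<in> U \<and> X k \<omega> \<in> D) = rocof a U D k P \<and>
      weak_conv_m
        (\<lambda>n. distr M borel (\<lambda>\<omega>. sqrt (real n) * (rocof a U D k (emp_trans X n \<omega>) - rocof a U D k P)))
        (distr N borel (\<lambda>\<omega>. (a v* (W_pow P (W \<omega>) (k - 1) ** ind_diag U ** P
                                    + matpow P (k - 1) ** ind_diag U ** W \<omega>)) \<bullet> ind_vec D))) \<and>
      weak_conv_m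
        (\<lambda>n. distr M borel (\<lambda>\<omega>. sqrt (real n) * (pihat n \<omega> \<bullet> ind_vec U - \<pi> \<bullet> ind_vec U)))
        (distr N borel (\<lambda>\<omega>. (\<pi> v* (W \<omega> ** matrix_inv (mat 1 - P + all_ones))) \<bullet> ind_vec U))"
proof -
  interpret finite_markov_chain M X P a
    by fact
  show ?thesis
    using prob_enter_eq_rocof weak_conv_rocof[OF assms(1-3,10)]
      weak_conv_stationary_plugin[OF assms(1-3,10-12)]
    by blast
qed

end
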